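(* Let $N=3$ and $p>1$. Suppose that $\zeta$ has full support on $[0,1]$ and that $\zeta$, restricted to some neighbourhood of zero, is a continuous random variable with a non-decreasing density (e.g. uniformly distributed). Let $(\mathcal X(t))_{t\ge 0}$ be the $p$-contest process with $3$ points and replacement distribution $\zeta$. Then $\mathcal X'(t)\to 1$ as $t\to\infty$ almost surely.
   Context: Unordered tuples are understood with repetitions. For $\mathcal X=\{x_1,\dots,x_N\}$ let $\mu_N=\frac1N\sum_{i=1}^N x_i$; the $p$-centre of mass is $p\mu_N$. The extreme point of $\mathcal X$ is the point farthest from $p\mu_N$ (it is the smallest or the largest point; in case of a tie between the left-most and the right-most point, either of them is chosen with equal probability). The core $\mathcal X'$ is the $(N-1)$-tuple obtained from $\mathcal X$ by removing the extreme point. The random variable $\zeta$ takes values in $[0,1]$; full support on $[0,1]$ means $\mathbb P(\zeta\in(a,b))>0$ for all $0\le a<b\le 1$. The $p$-contest process: given $\mathcal X(t)$ with core $\mathcal X'(t)$, set $\mathcal X(t+1)=\mathcal X'(t)\cup\{\zeta_{t+1}\}$, where $\zeta_1,\zeta_2,\dots$ are i.i.d. with the distribution of $\zeta$ (each newly sampled point being independent of the past). The initial configuration $\mathcal X(0)$ is arbitrary or random, the only requirement being that all its points lie in the support of $\zeta$. $x_{(1)}(t)\le x_{(2)}(t)$ denote the points of the core $\mathcal X'(t)$ in non-decreasing order, and $\mathcal X'(t)\to 1$ means $x_{(i)}(t)\to 1$ for $i=1,2$.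
   Formalization: For 1 < p < 3/2 it is additionally assumed that almost surely at most one of the three initial points equals 0; otherwise the core is {0,0} forever and does not converge to 1, so the claim fails exactly for the excluded starts. *)

theory Defs
  imports "HOL-Probability.Probability" "HOL-Library.Multiset"
begin

section \<open>Configurations: unordered tuples of real numbers\<close>

definition mean :: "real multiset \<Rightarrow> real" where
  "mean X = sum_mset X / real (size X)"

definition extreme_points :: "real \<Rightarrow> real multiset \<Rightarrow> real set" where
  "extreme_points p X =
     {x \<in> set_mset X. \<forall>y \<in> set_mset X. \<bar>y - p * mean X\<bar> \<le> \<bar>x - p * mean X\<bar>}"

text \<open>
  As a set of reals, \<^term>\<open>extreme_points p X\<close> has at most two elements: the smallest and the
  largest point of \<open>X\<close>. The Boolean \<open>b\<close> decides a tie between these two and has no influence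
  if there is no tie.
\<close>

definition extreme_point :: "real \<Rightarrow> bool \<Rightarrow> real multiset \<Rightarrow> real" where
  "extreme_point p b X = (if b then Min (extreme_points p X) else Max (extreme_points p X))"

definition core :: "real \<Rightarrow> bool \<Rightarrow> real multiset \<Rightarrow> real multiset" where
  "core p b X = X - {#extreme_point p b X#}"

text \<open>The \<open>i\<close>-th smallest point, counted from 1.\<close>

definition order_point :: "real multiset \<Rightarrow> nat \<Rightarrow> real" where
  "order_point X i = sorted_list_of_multiset X ! (i - 1)"

text \<open>
  The measurable space of unordered \<open>N\<close>-tuples: a random configuration is a map into this space
  whose order statistics are random variables.
\<close>

definition configurations :: "nat \<Rightarrow> real multiset measure" where
  "configurations N =
     vimage_algebra {X. size X = N} (\<lambda>X. \<lambda>i\<in>{1..N}. order_point X i) (\<Pi>\<^sub>M i\<in>{1..N}. borel)"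


section \<open>Replacement distributions\<close>

definition topological_support :: "real measure \<Rightarrow> real set" where
  "topological_support D = {x. \<forall>U. open U \<longrightarrow> x \<in> U \<longrightarrow> emeasure D U > 0}"

definition full_support :: "real measure \<Rightarrow> bool" where
  "full_support D \<longleftrightarrow> (\<forall>a b. 0 \<le> a \<and> a < b \<and> b \<le> 1 \<longrightarrow> measure D {a<..<b} > 0)"

text \<open>Neighbourhoods of zero are taken within \<open>[0,1]\<close>, where the distributions live.\<close>

definition nondecreasing_density_near_zero :: "real measure \<Rightarrow> bool" where
  "nondecreasing_density_near_zero D \<longleftrightarrow>
     (\<exists>\<epsilon>>0. \<exists>f :: real \<Rightarrow> real.
        f \<in> borel_measurable borel \<and>
        (\<forall>x\<in>{0..<\<epsilon>}. 0 \<le> f x) \<and>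
        mono_on {0..<\<epsilon>} f \<and>
        (\<forall>A\<in>sets borel. A \<subseteq> {0..<\<epsilon>} \<longrightarrow> emeasure D A = (\<integral>\<^sup>+x\<in>A. ennreal (f x) \<partial>lborel)))"


section \<open>The contest process\<close>

text \<open>
  The process is driven by three sources of randomness: the initial configuration, the newly
  sampled points \<open>\<zeta> 1, \<zeta> 2, \<dots>\<close> and the fair coins \<open>tie t\<close> that decide ties. The value \<open>\<zeta> 0\<close> is
  not used.
\<close>

datatype source = Initial | Sample nat | Tie nat

locale p_contest = prob_space M for M :: "'w measure" +
  fixes N :: nat and p :: real and D :: "real measure"
    and \<zeta> :: "nat \<Rightarrow> 'w \<Rightarrow> real" and tie :: "nat \<Rightarrow> 'w \<Rightarrow> bool"
    and X :: "nat \<Rightarrow> 'w \<Rightarrow> real multiset"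
  assumes initial_measurable: "X 0 \<in> M \<rightarrow>\<^sub>M configurations N"
    and sample_measurable: "\<And>t. \<zeta> (Suc t) \<in> M \<rightarrow>\<^sub>M borel"
    and tie_measurable: "\<And>t. tie t \<in> M \<rightarrow>\<^sub>M count_space UNIV"
    and independent: "indep_sets (\<lambda>s. case s of
           Initial \<Rightarrow> sets (vimage_algebra (space M) (X 0) (configurations N))
         | Sample t \<Rightarrow> sets (vimage_algebra (space M) (\<zeta> (Suc t)) borel)
         | Tie t \<Rightarrow> sets (vimage_algebra (space M) (tie t) (count_space UNIV))) UNIV"
    and sample_distribution: "\<And>t. distr M borel (\<zeta> (Suc t)) = D"
    and sample_in_unit_interval: "measure D {0..1} = 1"
    and tie_fair: "\<And>t. prob {\<omega> \<in> space M. tie t \<omega>} = 1 / 2"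
    and initial_in_support: "AE \<omega> in M. set_mset (X 0 \<omega>) \<subseteq> topological_support D"
    and step: "\<And>t \<omega>. \<omega> \<in> space M \<Longrightarrow>
                 X (Suc t) \<omega> = add_mset (\<zeta> (Suc t) \<omega>) (core p (tie t \<omega>) (X t \<omega>))"

text \<open>
  For \<open>0 < p < 3/2\<close> a configuration of three points in \<open>[0,1]\<close> with two of them at zero is
  absorbing: the third point is always the one that is discarded. So, although zero belongs to the
  support of a distribution with full support, such initial configurations have to be excluded in
  any statement about convergence to 1.
\<close>

lemma core_two_zeros:
  assumes "0 < p" "p < 3 / 2" "0 \<le> z"
  shows "core p b {#z, 0, 0#} = {#0, 0#}"
proof -
  have "extreme_points p {#z, 0, 0#} = {z}"
  proof (cases "z = 0")
    case True
    then show ?thesis by (auto simp: extreme_points_def)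
  next
    case False
    with assms have z: "z > 0" by simp
    have m: "mean {#z, 0, 0#} = z / 3" by (simp add: mean_def)
    have pz: "p * z < 3 / 2 * z" "0 < p * z" using assms z by auto
    then have "\<bar>0 - p * (z / 3)\<bar> < \<bar>z - p * (z / 3)\<bar>" by linarith
    then show ?thesis unfolding extreme_points_def m by auto
  qed
  then show ?thesis by (simp add: core_def extreme_point_def)
qed

end

theory Submission
  imports Defs "HOL-Real_Asymp.Real_Asymp"
begin

text \<open>
  With three points the core is a pair \<open>x \<le> y\<close>, and a step either discards the smallest or the largest
  of \<open>x\<close>, \<open>y\<close> and the new point \<open>z\<close>. The proof has two halves.

  Away from zero the contest moves up. If \<open>y \<ge> d > 0\<close> infinitely often, then infinitely many of
  these times are followed by a new point in any prescribed interval
  (\<open>infinitely_often_hits\<close>, a conditional Borel--Cantelli lemma). New points slightly above \<open>y\<close> raise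
  \<open>y\<close> by a fixed factor (\<open>next_hi_climbs\<close>), until both points exceed a level \<open>\<rho> < 1\<close> above which
  the smallest point always loses (\<open>next_core_top_two\<close>). From then on the core consists of the two largest
  points seen since then, and it tends to 1.

  It remains to exclude that the core tends to zero, which is where the density is used. For \<open>p = 1\<close> the
  dynamics is symmetric under reflection, except for the boundary at zero, and \<open>p > 1\<close> only helps: the smallest point loses at least
  as often as for \<open>p = 1\<close>. So it suffices to find a function of the core that is decreasing in both points,
  tends to infinity at zero, and does not increase on average under the dynamics with \<open>p = 1\<close> and \<open>z\<close> drawn
  from Lebesgue measure. Such a function is \<open>- ln (max (3 x) y)\<close>. A new point to the left of the
  midpoint of \<open>x\<close> and \<open>y\<close> can only increase it, a new point to the right can only decrease it; hence replacing Lebesgue measure by a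
  non-decreasing density can only improve the balance (\<open>nn_integral_loss_le_gain\<close>). The balance itself,
  \<open>expected_log_weight_drift\<close>, is an elementary inequality between logarithms in the two cases \<open>y \<le> 3 x\<close> and
  \<open>y > 3 x\<close>. As long as the core is close to zero, the function is thus a non-negative
  supermartingale, which almost surely does not tend to infinity (\<open>AE_hi_not_tendsto_0\<close>).
\<close>

section \<open>Cores of three points\<close>

text \<open>
  The farthest point from a reference point is always the smallest or the largest one. With
  reference point \<open>p\<close> times the mean, comparing the distances of the extremes \<open>m\<close> and \<open>M\<close> gives the
  linear condition \<open>m + M < 2 p (m + c + M) / 3\<close>. In a tie a true \<open>b\<close> selects the smaller of the two.
\<close>
definition removes_min :: "real \<Rightarrow> bool \<Rightarrow> real \<Rightarrow> real \<Rightarrow> real \<Rightarrow> bool" where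
  "removes_min p b m c M \<longleftrightarrow>
     3 * (m + M) < 2 * p * (m + c + M) \<or> 3 * (m + M) = 2 * p * (m + c + M) \<and> b"

lemma core_sorted_triple:
  assumes "m \<le> c" "c \<le> M"
  shows "core p b {#m, c, M#} = (if removes_min p b m c M then {#c, M#} else {#m, c#})"
proof -
  define u where "u = p * mean {#m, c, M#}"
  have u: "6 * u = 2 * p * (m + c + M)"
    by (simp add: u_def mean_def)
  define E where "E = extreme_points p {#m, c, M#}"
  have E: "E = {e \<in> {m, c, M}. \<bar>m - u\<bar> \<le> \<bar>e - u\<bar> \<and> \<bar>c - u\<bar> \<le> \<bar>e - u\<bar> \<and> \<bar>M - u\<bar> \<le> \<bar>e - u\<bar>}"
    unfolding E_def extreme_points_def u_def by auto
  have core: "core p b {#m, c, M#} = {#m, c, M#} - {#if b then Min E else Max E#}"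
    by (simp add: core_def extreme_point_def E_def)
  consider "m + M < 2 * u" | "m + M > 2 * u" | "m + M = 2 * u" by linarith
  then show ?thesis
  proof cases
    case 1
    then have "E = {m}"
      unfolding E using assms by auto
    then show ?thesis
      using 1 u unfolding core removes_min_def by auto
  next
    case 2
    then have "E = {M}"
      unfolding E using assms by auto
    then show ?thesis
      using 2 u unfolding core removes_min_def by (auto simp: add_mset_commute)
  next
    case 3
    then have "E = {m, M}"
      unfolding E using assms by auto
    then show ?thesis
      using 3 u assms unfolding core removes_min_def by (auto simp: add_mset_commute)
  qed
qed

text \<open>
  From here on a core is a pair \<open>x \<le> y\<close>, and a step of the contest is the map
  \<open>(x, y) \<mapsto> (next_lo p b x y z, next_hi p b x y z)\<close>.
\<close>
definition middle :: "real \<Rightarrow> real \<Rightarrow> real \<Rightarrow> real" where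
  "middle x y z = max x (min y z)"

definition drops_min :: "real \<Rightarrow> bool \<Rightarrow> real \<Rightarrow> real \<Rightarrow> real \<Rightarrow> bool" where
  "drops_min p b x y z \<longleftrightarrow> removes_min p b (min x z) (middle x y z) (max y z)"

definition next_lo :: "real \<Rightarrow> bool \<Rightarrow> real \<Rightarrow> real \<Rightarrow> real \<Rightarrow> real" where
  "next_lo p b x y z = (if drops_min p b x y z then middle x y z else min x z)"

definition next_hi :: "real \<Rightarrow> bool \<Rightarrow> real \<Rightarrow> real \<Rightarrow> real \<Rightarrow> real" where
  "next_hi p b x y z = (if drops_min p b x y z then max y z else middle x y z)"

lemma triple_sorted:
  assumes "x \<le> y"
  shows "{#z, x, y#} = {#min x z, middle x y z, max y z#}"
  using assms by (auto simp: middle_def min_def max_def add_mset_commute)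

lemma core_add_point:
  assumes "x \<le> y"
  shows "core p b {#z, x, y#} = {#next_lo p b x y z, next_hi p b x y z#}"
proof -
  have "core p b {#min x z, middle x y z, max y z#} = {#next_lo p b x y z, next_hi p b x y z#}"
    using assms by (subst core_sorted_triple) (auto simp: next_lo_def next_hi_def drops_min_def middle_def)
  then show ?thesis
    using triple_sorted[OF assms, of z] by simp
qed

lemma order_point_pair:
  assumes "a \<le> b"
  shows "order_point {#a, b#} (Suc 0) = a" "order_point {#a, b#} 2 = b"
  using assms by (simp_all add: order_point_def numeral_2_eq_2)

lemma next_lo_le_next_hi: "x \<le> y \<Longrightarrow> next_lo p b x y z \<le> next_hi p b x y z"
  by (auto simp: next_lo_def next_hi_def middle_def)

lemma next_between:
  assumes "x \<le> y"
  shows "min x z \<le> next_lo p b x y z" "next_hi p b x y z \<le> max y z" "middle x y z \<le> next_hi p b x y z"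
  using assms by (auto simp: next_lo_def next_hi_def middle_def)

lemma next_of_drops_min:
  assumes "3 * (min x z + max y z) < 2 * p * (min x z + middle x y z + max y z)"
  shows "next_lo p b x y z = middle x y z" "next_hi p b x y z = max y z"
  using assms by (auto simp: next_lo_def next_hi_def drops_min_def removes_min_def)

text \<open>
  Comparison with \<open>p = 1\<close>: there the point farther from the middle one loses, which is the smallest
  point if \<open>min x z + max y z < 2 * middle x y z\<close>. A larger \<open>p\<close> moves the reference point to the
  right and can only make the smallest point lose more often.
\<close>
lemma drops_min_if_middle_high:
  assumes "1 < p" "0 \<le> x" "x \<le> y" "0 < y" "0 \<le> z" "min x z + max y z \<le> 2 * middle x y z"
  shows "3 * (min x z + max y z) < 2 * p * (min x z + middle x y z + max y z)"
proof -
  let ?s = "min x z + middle x y z + max y z"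
  have "0 < ?s" using assms by (auto simp: middle_def)
  then have "1 * ?s < p * ?s" using \<open>1 < p\<close> by (intro mult_strict_right_mono)
  then show ?thesis using assms(6) by (simp add: mult.assoc)
qed

text \<open>
  The Lyapunov function of the proof is \<open>- ln (weight x y)\<close>. The dynamics near
  zero is invariant under scaling, hence the weight is homogeneous. It is \<open>3 x\<close> for a core of comparable points
  and \<open>y\<close> once \<open>x\<close> is negligible, so that a new point close to zero cannot make it collapse
  unless both points become small.
\<close>
definition weight :: "real \<Rightarrow> real \<Rightarrow> real" where
  "weight x y = max (3 * x) y"

text \<open>
  The weight after a step of the contest with \<open>p = 1\<close>. As the weight is increasing in both
  points, keeping the two upper points is never worse than keeping the two lower ones; hence this
  is a lower bound for every \<open>p > 1\<close>, and it depends neither on \<open>p\<close> nor on the coin.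
\<close>
definition next_weight_bound :: "real \<Rightarrow> real \<Rightarrow> real \<Rightarrow> real" where
  "next_weight_bound x y z =
     (if min x z + max y z < 2 * middle x y z then weight (middle x y z) (max y z)
      else weight (min x z) (middle x y z))"

lemma next_weight_bound_le:
  assumes "1 < p" "0 \<le> x" "x \<le> y" "0 < y" "0 \<le> z"
  shows "next_weight_bound x y z \<le> weight (next_lo p b x y z) (next_hi p b x y z)"
proof (cases "min x z + max y z < 2 * middle x y z")
  case True
  then show ?thesis
    using next_of_drops_min[OF drops_min_if_middle_high[OF assms]]
    by (simp add: next_weight_bound_def)
next
  case False
  then show ?thesis using assms next_between[OF assms(3), where z = z and p = p and b = b]
    by (auto simp: next_weight_bound_def weight_def)
qed

lemma next_weight_bound_pos:
  assumes "0 \<le> x" "x \<le> y" "0 < y" "0 < z"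
  shows "0 < next_weight_bound x y z"
  using assms by (auto simp: next_weight_bound_def weight_def middle_def)

lemma next_weight_bound_measurable [measurable]:
  assumes [measurable]: "f \<in> borel_measurable S" "g \<in> borel_measurable S" "h \<in> borel_measurable S"
  shows "(\<lambda>w. next_weight_bound (f w) (g w) (h w)) \<in> borel_measurable S"
  unfolding next_weight_bound_def weight_def middle_def by measurable

text \<open>
  If the new point lands in \<open>(y, p y]\<close>, the smallest point loses, so that the core can gain a fixed
  factor. If it lands at or below \<open>y\<close>, the middle point is at least \<open>z\<close>, and the larger point of the
  next core is never below the middle point.
\<close>
lemma next_hi_climbs:
  assumes p: "1 < p" and xy: "0 \<le> x" "x \<le> y" "0 < y" and z: "0 \<le> z" "z \<le> p * y"
  shows "z \<le> next_hi p b x y z"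
proof (cases "z \<le> y")
  case True
  then have "z \<le> middle x y z"
    by (simp add: middle_def)
  then show ?thesis
    using next_between(3)[OF xy(2)] order_trans by blast
next
  case False
  have "3 * (x + z) < 2 * p * (x + y + z)"
  proof (cases "3 \<le> 2 * p")
    case True
    have "3 * (x + z) < 3 * (x + y + z)" using xy by simp
    also have "\<dots> \<le> 2 * p * (x + y + z)"
      using True xy z by (intro mult_right_mono) auto
    finally show ?thesis .
  next
    case p': False
    have "(3 - 2 * p) * (x + z) \<le> (3 - 2 * p) * ((1 + p) * y)"
      using p' xy z by (intro mult_left_mono) (auto simp: algebra_simps)
    also have "\<dots> < 2 * p * y"
    proof -
      have "0 < (p - 1) * (2 * p + 3)" using p by simp
      then have "(3 - 2 * p) * (1 + p) < 2 * p" by (simp add: algebra_simps)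
      then show ?thesis using xy(3) by (metis mult.assoc mult_strict_right_mono)
    qed
    finally show ?thesis by (simp add: algebra_simps)
  qed
  then show ?thesis
    using False xy by (subst next_of_drops_min) (auto simp: middle_def)
qed

text \<open>
  The absorbing regime. The smallest point loses as soon as the middle one exceeds
  \<open>(3 - 2 p) / (4 p - 3)\<close>, a number below 1: the worst case is \<open>m = c\<close>, \<open>M = 1\<close>.
  The condition on \<open>\<rho>\<close> is written without a quotient.
\<close>
lemma next_core_top_two:
  assumes p: "1 < p" and \<rho>: "0 < \<rho>" "3 - 2 * p < (4 * p - 3) * \<rho>"
    and xy: "0 \<le> x" "x \<le> y" "y \<le> 1" and z: "0 \<le> z" "z \<le> 1" and c: "\<rho> \<le> middle x y z"
  shows "next_lo p b x y z = middle x y z" "next_hi p b x y z = max y z"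
proof -
  let ?m = "min x z" and ?c = "middle x y z" and ?M = "max y z"
  have ord: "0 \<le> ?m" "?m \<le> ?c" "?c \<le> ?M" "?M \<le> 1"
    using xy z by (auto simp: middle_def)
  have "3 * (?m + ?M) < 2 * p * (?m + ?c + ?M)"
  proof (cases "3 \<le> 2 * p")
    case True
    have "3 * (?m + ?M) < 3 * (?m + ?c + ?M)" using c \<rho>(1) by simp
    also have "\<dots> \<le> 2 * p * (?m + ?c + ?M)"
      using True ord by (intro mult_right_mono) auto
    finally show ?thesis .
  next
    case p': False
    have "(3 - 2 * p) * (?m + ?M) \<le> (3 - 2 * p) * (?c + 1)"
      using p' ord by (intro mult_left_mono) auto
    also have "\<dots> < 2 * p * ?c"
    proof -
      have "(4 * p - 3) * \<rho> \<le> (4 * p - 3) * ?c"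
        using p c by (intro mult_left_mono) auto
      then show ?thesis using \<rho>(2) by (simp add: algebra_simps)
    qed
    finally show ?thesis by (simp add: algebra_simps)
  qed
  then show "next_lo p b x y z = ?c" "next_hi p b x y z = ?M"
    by (simp_all add: next_of_drops_min)
qed

lemma next_hi_pos:
  assumes "0 \<le> x" "x \<le> y" "0 < y" "0 < z"
  shows "0 < next_hi p b x y z"
  using assms next_between(3)[OF assms(2), of z p b] by (auto simp: middle_def)

text \<open>
  For \<open>p \<ge> 3 / 2\<close> the core \<open>{0, 0}\<close> is admitted as a start. It is left at the first true coin: at
  \<open>p = 3 / 2\<close> there is a tie between \<open>0\<close> and the new point, for larger \<open>p\<close> zero loses anyway.
\<close>
lemma next_hi_pos_of_zeros:
  assumes "3 / 2 \<le> p" "0 < z"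
  shows "next_hi p True 0 0 z = z"
  using assms by (auto simp: next_hi_def drops_min_def removes_min_def middle_def)

section \<open>The logarithmic drift near zero\<close>

locale nondecreasing_density = prob_space D for D :: "real measure" +
  fixes f :: "real \<Rightarrow> real" and \<epsilon> :: real
  assumes sets_D [measurable_cong]: "sets D = sets borel"
    and f_measurable [measurable]: "f \<in> borel_measurable borel"
    and f_mono: "mono_on {0..<\<epsilon>} f"
    and emeasure_near_zero: "\<And>A. A \<in> sets borel \<Longrightarrow> A \<subseteq> {0..<\<epsilon>} \<Longrightarrow>
      emeasure D A = (\<integral>\<^sup>+z\<in>A. ennreal (f z) \<partial>lborel)"
begin

text \<open>
  Chebyshev's inequality for a non-decreasing density: losses lie to the left of \<open>m\<close>, where the
  density is at most \<open>f m\<close>, and gains to the right of \<open>m\<close>, where it is at least \<open>f m\<close>. A balance in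
  Lebesgue measure therefore carries over to \<open>D\<close>.
\<close>
lemma nn_integral_loss_le_gain:
  fixes loss gain :: "real \<Rightarrow> ennreal"
  assumes [measurable]: "loss \<in> borel_measurable borel" "gain \<in> borel_measurable borel"
    and m: "0 \<le> m" "m < \<epsilon>"
    and loss: "\<And>z. z \<notin> {0..m} \<Longrightarrow> loss z = 0" and gain: "\<And>z. z \<notin> {m<..<\<epsilon>} \<Longrightarrow> gain z = 0"
    and le: "(\<integral>\<^sup>+z. loss z \<partial>lborel) \<le> (\<integral>\<^sup>+z. gain z \<partial>lborel)"
  shows "(\<integral>\<^sup>+z. loss z \<partial>D) \<le> (\<integral>\<^sup>+z. gain z \<partial>D)"
proof -
  define J :: "real set" where "J = {0..<\<epsilon>}"
  define k :: "real \<Rightarrow> ennreal" where "k z = ennreal (f z) * indicator J z" for z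
  have [measurable]: "J \<in> sets borel" by (simp add: J_def)
  have [measurable]: "k \<in> borel_measurable borel" unfolding k_def by measurable
  \<comment> \<open>On \<open>J\<close> the distribution \<open>D\<close> has density \<open>k\<close>, as an identity of measures.\<close>
  have eq: "density D (indicator J) = density lborel k"
  proof (rule measure_eqI)
    fix A assume "A \<in> sets (density D (indicator J))"
    then have [measurable]: "A \<in> sets borel" using sets_D by simp
    have "emeasure (density D (indicator J)) A = (\<integral>\<^sup>+z. indicator J z * indicator A z \<partial>D)"
      by (rule emeasure_density) simp_all
    also have "\<dots> = (\<integral>\<^sup>+z. indicator (J \<inter> A) z \<partial>D)"
      by (simp only: indicator_inter_arith)
    also have "\<dots> = emeasure D (J \<inter> A)"
      by (rule nn_integral_indicator) simp
    also have "\<dots> = (\<integral>\<^sup>+z\<in>J \<inter> A. ennreal (f z) \<partial>lborel)"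
      by (rule emeasure_near_zero) (auto simp: J_def)
    also have "\<dots> = emeasure (density lborel k) A"
      by (subst emeasure_density) (auto intro!: nn_integral_cong simp: indicator_def k_def)
    finally show "emeasure (density D (indicator J)) A = emeasure (density lborel k) A" .
  qed (simp add: sets_D)
  have transfer: "(\<integral>\<^sup>+z. h z \<partial>D) = (\<integral>\<^sup>+z. k z * h z \<partial>lborel)"
    if [measurable]: "h \<in> borel_measurable borel" and "\<And>z. z \<notin> J \<Longrightarrow> h z = 0" for h
  proof -
    have "(\<integral>\<^sup>+z. h z \<partial>D) = (\<integral>\<^sup>+z. indicator J z * h z \<partial>D)"
      using that(2) by (auto intro!: nn_integral_cong simp: indicator_def)
    also have "\<dots> = (\<integral>\<^sup>+z. h z \<partial>density D (indicator J))"
      by (subst nn_integral_density) auto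
    also have "\<dots> = (\<integral>\<^sup>+z. k z * h z \<partial>lborel)"
      unfolding eq by (subst nn_integral_density) auto
    finally show ?thesis .
  qed
  have f_le: "f a \<le> f b" if "a \<in> J" "b \<in> J" "a \<le> b" for a b
    using f_mono that unfolding J_def by (auto intro: mono_onD)
  have "(\<integral>\<^sup>+z. loss z \<partial>D) = (\<integral>\<^sup>+z. k z * loss z \<partial>lborel)"
    using loss m by (intro transfer) (auto simp: J_def)
  also have "\<dots> \<le> (\<integral>\<^sup>+z. ennreal (f m) * loss z \<partial>lborel)"
  proof (rule nn_integral_mono)
    fix z :: real
    show "k z * loss z \<le> ennreal (f m) * loss z"
    proof (cases "z \<in> {0..m}")
      case True
      then have "f z \<le> f m" using m by (intro f_le) (auto simp: J_def)
      then show ?thesis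
        by (intro mult_right_mono) (auto simp: k_def indicator_def intro: ennreal_leI)
    qed (simp add: loss)
  qed
  also have "\<dots> = ennreal (f m) * (\<integral>\<^sup>+z. loss z \<partial>lborel)"
    by (rule nn_integral_cmult) simp
  also have "\<dots> \<le> ennreal (f m) * (\<integral>\<^sup>+z. gain z \<partial>lborel)"
    using le by (rule mult_left_mono) simp
  also have "\<dots> = (\<integral>\<^sup>+z. ennreal (f m) * gain z \<partial>lborel)"
    by (rule nn_integral_cmult[symmetric]) simp
  also have "\<dots> \<le> (\<integral>\<^sup>+z. k z * gain z \<partial>lborel)"
  proof (rule nn_integral_mono)
    fix z :: real
    show "ennreal (f m) * gain z \<le> k z * gain z"
    proof (cases "z \<in> {m<..<\<epsilon>}")
      case True
      then have "f m \<le> f z" "z \<in> J" using m by (auto intro!: f_le simp: J_def)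
      then show ?thesis
        by (intro mult_right_mono) (auto simp: k_def intro: ennreal_leI)
    qed (simp add: gain)
  qed
  also have "\<dots> = (\<integral>\<^sup>+z. gain z \<partial>D)"
    using gain m by (intro transfer[symmetric]) (auto simp: J_def)
  finally show ?thesis .
qed

text \<open>
  The gain is kept on the left of the pointwise inequality, so that everything stays non-negative
  and no integrability has to be checked; its integral, finite because the gain is bounded, is
  cancelled at the end.
\<close>
lemma expectation_le_of_loss_le_gain:
  fixes h loss gain :: "real \<Rightarrow> real"
  assumes [measurable]: "h \<in> borel_measurable borel" "loss \<in> borel_measurable borel"
      "gain \<in> borel_measurable borel"
    and m: "0 \<le> m" "m < \<epsilon>"
    and loss: "\<And>z. 0 \<le> loss z" "\<And>z. z \<notin> {0..m} \<Longrightarrow> loss z = 0"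
    and gain: "\<And>z. 0 \<le> gain z" "\<And>z. gain z \<le> K" "\<And>z. z \<notin> {m<..<\<epsilon>} \<Longrightarrow> gain z = 0"
    and le: "(\<integral>\<^sup>+z. loss z \<partial>lborel) \<le> (\<integral>\<^sup>+z. gain z \<partial>lborel)"
    and v: "0 \<le> v" and h: "AE z in D. 0 \<le> h z \<and> h z + gain z \<le> v + loss z"
  shows "(\<integral>\<^sup>+z. h z \<partial>D) \<le> ennreal v"
proof -
  let ?G = "\<integral>\<^sup>+z. gain z \<partial>D"
  have "?G \<le> (\<integral>\<^sup>+z. ennreal K \<partial>D)"
    using gain(2) by (intro nn_integral_mono ennreal_leI)
  then have G: "?G < \<top>"
    by (simp add: emeasure_space_1 le_less_trans)
  have "(\<integral>\<^sup>+z. h z \<partial>D) + ?G = (\<integral>\<^sup>+z. ennreal (h z) + ennreal (gain z) \<partial>D)"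
    by (rule nn_integral_add[symmetric]) auto
  also have "\<dots> \<le> (\<integral>\<^sup>+z. ennreal v + ennreal (loss z) \<partial>D)"
  proof (rule nn_integral_mono_AE)
    show "AE z in D. ennreal (h z) + ennreal (gain z) \<le> ennreal v + ennreal (loss z)"
      using h
    proof eventually_elim
      case (elim z)
      then have "ennreal (h z + gain z) \<le> ennreal (v + loss z)"
        by (intro ennreal_leI) simp
      then show ?case
        using elim gain(1) loss(1) v by simp
    qed
  qed
  also have "\<dots> = ennreal v + (\<integral>\<^sup>+z. loss z \<partial>D)"
    by (subst nn_integral_add) (auto simp: emeasure_space_1)
  also have "\<dots> \<le> ennreal v + ?G"
    using loss gain le m by (intro add_left_mono nn_integral_loss_le_gain[of _ _ m]) auto
  finally show ?thesis
    using G by (auto simp: add.commute)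
qed

end

lemma ln_chord:
  fixes a b t :: real
  assumes "0 < a" "0 < b" "0 \<le> t" "t \<le> 1"
  shows "(1 - t) * ln a + t * ln b \<le> ln ((1 - t) * a + t * b)"
  using concave_onD[OF ln_concave, of t a b] assms by simp

lemma ln_one_plus_ge:
  assumes "0 \<le> u" "u \<le> (1::real)"
  shows "u * ln 2 \<le> ln (1 + u)"
  using ln_chord[of 1 2 u] assms by (simp add: algebra_simps)

lemma ln_max_third_ge:
  assumes "0 \<le> u" "u \<le> (1::real)"
  shows "- (3 / 2 * ln 3 * (1 - u)) \<le> ln (max u (1 / 3))"
proof (cases "u \<le> 1 / 3")
  case True
  have "2 * ln 3 \<le> (1 - u) * 3 * ln (3::real)"
    using True by (intro mult_right_mono) auto
  moreover have "max u (1 / 3) = 1 / 3" using True by simp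
  ultimately show ?thesis by (simp add: ln_div)
next
  case False
  define t where "t = 3 / 2 * (1 - u)"
  have "t * ln (1 / 3) \<le> ln ((1 - t) * 1 + t * (1 / 3))"
    using ln_chord[of 1 "1 / 3" t] False assms by (simp add: t_def)
  moreover have "(1 - t) * 1 + t * (1 / 3) = u"
    by (simp add: t_def field_simps)
  ultimately have "- (3 / 2 * ln 3 * (1 - u)) \<le> ln u"
    by (simp add: ln_div t_def field_simps)
  then show ?thesis using False by (simp add: max_def)
qed

text \<open>
  Comparable points, \<open>y \<le> 3 x\<close>: the weight is \<open>3 x\<close>. It can shrink only if \<open>z\<close> lands between
  \<open>2 x - y\<close> and \<open>x\<close>, and then by a factor of at least \<open>1 / 3\<close>, so that concavity of the logarithm
  bounds the loss by a linear function. It grows if \<open>z\<close> lands between the midpoint and \<open>2 y - x\<close>.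
\<close>
lemma weight_le_bound_near:
  assumes xy: "0 < x" "x \<le> y" "y \<le> 3 * x" and z: "0 < z"
  shows "ln (3 / next_weight_bound x y z)
      + (if (x + y) / 2 < z \<and> z \<le> y then ln ((x + y) / 2 / x)
         else if y < z \<and> z < 2 * y - x then ln (y / x) else 0)
    \<le> ln (3 / weight x y)
      + (if max 0 (2 * x - y) \<le> z \<and> z \<le> x then 3 / 2 * ln 3 * ((x - z) / x) else 0)"
    (is "_ + ?g \<le> _ + ?l")
proof -
  let ?w = "next_weight_bound x y z"
  have w: "0 < ?w" using assms by (intro next_weight_bound_pos) auto
  have weight: "weight x y = 3 * x" using xy by (simp add: weight_def)
  have "?g - ?l \<le> ln (?w / (3 * x))"
  proof -
    consider "z < x" "z < 2 * x - y" | "z < x" "2 * x - y \<le> z" | "x \<le> z" "z \<le> (x + y) / 2"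
      | "(x + y) / 2 < z" "z \<le> y" | "y < z" "z < 2 * y - x" | "y < z" "2 * y - x \<le> z"
      by linarith
    then show ?thesis
    proof cases
      case 1
      then have "?w = 3 * x"
        using xy z by (auto simp: next_weight_bound_def middle_def weight_def)
      then show ?thesis using 1 xy by auto
    next
      case 2
      then have "?w = weight z x"
        using xy z by (auto simp: next_weight_bound_def middle_def)
      then have "?w / (3 * x) = max (z / x) (1 / 3)"
        using xy by (auto simp: weight_def max_def field_simps)
      moreover have "- (3 / 2 * ln 3 * (1 - z / x)) \<le> ln (max (z / x) (1 / 3))"
        using 2 xy z by (intro ln_max_third_ge) (auto simp: field_simps)
      moreover have "1 - z / x = (x - z) / x" using xy by (simp add: field_simps)
      ultimately show ?thesis using 2 xy z by simp
    next
      case 3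
      then have "?w = 3 * x"
        using xy z by (auto simp: next_weight_bound_def middle_def weight_def)
      then show ?thesis using 3 xy by auto
    next
      case 4
      then have "3 * ((x + y) / 2) \<le> ?w"
        using xy z by (auto simp: next_weight_bound_def middle_def weight_def)
      then have "3 * ((x + y) / 2) / (3 * x) \<le> ?w / (3 * x)"
        using xy by (intro divide_right_mono) auto
      moreover have "3 * ((x + y) / 2) / (3 * x) = (x + y) / 2 / x"
        using xy by (simp add: field_simps)
      ultimately have "(x + y) / 2 / x \<le> ?w / (3 * x)" by simp
      moreover have "0 < (x + y) / 2 / x" using xy by simp
      ultimately have "ln ((x + y) / 2 / x) \<le> ln (?w / (3 * x))"
        by (subst ln_le_cancel_iff) auto
      moreover have "x \<le> (x + y) / 2" using xy by simp
      ultimately show ?thesis using 4 by simp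
    next
      case 5
      then have "y / x \<le> ?w / (3 * x)"
        using xy z by (auto simp: next_weight_bound_def middle_def weight_def field_simps)
      moreover have "0 < y / x" using xy by simp
      ultimately have "ln (y / x) \<le> ln (?w / (3 * x))"
        by (subst ln_le_cancel_iff) auto
      then show ?thesis using 5 xy by auto
    next
      case 6
      then have "?w = 3 * x"
        using xy z by (auto simp: next_weight_bound_def middle_def weight_def)
      then show ?thesis using 6 xy by auto
    qed
  qed
  moreover have "ln (?w / (3 * x)) = ln (3 / weight x y) - ln (3 / ?w)"
    using w xy by (simp add: weight ln_div ln_mult)
  ultimately show ?thesis by linarith
qed

text \<open>
  Distant points, \<open>3 x < y\<close>: the weight is \<open>y\<close>. It can shrink only if \<open>z\<close> lands below the
  midpoint, where \<open>max x z\<close> remains. If \<open>z\<close> lands between \<open>y\<close> and \<open>2 y - x\<close>, then \<open>y\<close> becomes the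
  smaller point and the weight at least triples.
\<close>
lemma weight_le_bound_far:
  assumes xy: "0 \<le> x" "3 * x < y" and z: "0 < z"
  shows "ln (3 / next_weight_bound x y z) + (if y < z \<and> z < 2 * y - x then ln 3 else 0)
    \<le> ln (3 / weight x y) + (if 0 \<le> z \<and> z \<le> (x + y) / 2 then ln (y / max x z) else 0)"
    (is "_ + ?g \<le> _ + ?l")
proof -
  let ?w = "next_weight_bound x y z"
  have w: "0 < ?w" using assms by (intro next_weight_bound_pos) auto
  have weight: "weight x y = y" using xy by (simp add: weight_def)
  have "?g - ?l \<le> ln (?w / y)"
  proof -
    consider "z \<le> (x + y) / 2" | "(x + y) / 2 < z" "z \<le> y" | "y < z" "z < 2 * y - x"
      | "y < z" "2 * y - x \<le> z"
      by linarith
    then show ?thesis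
    proof cases
      case 1
      then have "max x z \<le> ?w"
        using xy z by (auto simp: next_weight_bound_def middle_def weight_def)
      then have "max x z / y \<le> ?w / y"
        using xy by (intro divide_right_mono) auto
      then have "ln (max x z / y) \<le> ln (?w / y)"
        using xy z w by (subst ln_le_cancel_iff) auto
      moreover have "ln (max x z / y) = - ln (y / max x z)"
        using xy z by (subst (1 2) ln_div) auto
      ultimately show ?thesis using 1 xy z by auto
    next
      case 2
      then have "1 \<le> ?w / y"
        using xy z by (auto simp: next_weight_bound_def middle_def weight_def)
      then have "0 \<le> ln (?w / y)" by simp
      then show ?thesis using 2 by auto
    next
      case 3
      then have "3 \<le> ?w / y"
        using xy z by (auto simp: next_weight_bound_def middle_def weight_def field_simps)
      then have "ln 3 \<le> ln (?w / y)" by simp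
      then show ?thesis using 3 xy by auto
    next
      case 4
      then have "?w = y"
        using xy z by (auto simp: next_weight_bound_def middle_def weight_def)
      then show ?thesis using 4 xy by auto
    qed
  qed
  moreover have "ln (?w / y) = ln (3 / weight x y) - ln (3 / ?w)"
    using w xy by (simp add: weight ln_div ln_mult)
  ultimately show ?thesis by linarith
qed

lemma nn_integral_linear_loss:
  assumes "0 < x" "a \<le> x" "0 \<le> K"
  shows "(\<integral>\<^sup>+z. ennreal (if a \<le> z \<and> z \<le> x then K * ((x - z) / x) else 0) \<partial>lborel)
    = ennreal (K / 2 * ((x - a)\<^sup>2 / x))"
proof -
  have "((\<lambda>z. K * ((x - z) / x)) has_integral - (K / 2 * ((x - x)\<^sup>2 / x)) - - (K / 2 * ((x - a)\<^sup>2 / x))) {a..x}"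
  proof (rule fundamental_theorem_of_calculus)
    show "((\<lambda>z. - (K / 2 * ((x - z)\<^sup>2 / x))) has_vector_derivative K * ((x - z) / x)) (at z within {a..x})"
      for z
      unfolding has_real_derivative_iff_has_vector_derivative[symmetric]
      using \<open>0 < x\<close> by (auto intro!: derivative_eq_intros simp: field_simps)
  qed fact
  then have "(\<integral>\<^sup>+z. ennreal (K * ((x - z) / x)) * indicator {a..x} z \<partial>lborel) = ennreal (K / 2 * ((x - a)\<^sup>2 / x))"
    using assms by (intro nn_integral_has_integral_lebesgue') auto
  moreover have "ennreal (if a \<le> z \<and> z \<le> x then K * ((x - z) / x) else 0)
      = ennreal (K * ((x - z) / x)) * indicator {a..x} z" for z
    by (auto simp: indicator_def)
  ultimately show ?thesis by simp
qed

text \<open>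
  In units of \<open>x\<close> and with \<open>d = (y - x) / x\<close>, \<open>e = min d 1\<close>, the loss is \<open>3/4 ln 3 \<cdot> e\<^sup>2\<close>, and
  the gain is at least \<open>5/4 ln 2 \<cdot> e\<^sup>2\<close>, because \<open>ln (1 + u) \<ge> u ln 2\<close> on the unit interval. The
  constants fit since \<open>3\<^sup>3 \<le> 2\<^sup>5\<close>.
\<close>
lemma near_loss_le_gain:
  fixes x y :: real
  assumes "0 < x" "x \<le> y" "y \<le> 3 * x"
  shows "3 / 2 * ln 3 / 2 * ((x - max 0 (2 * x - y))\<^sup>2 / x)
    \<le> ln ((x + y) / 2 / x) * (y - (x + y) / 2) + ln (y / x) * (y - x)"
proof -
  define d where "d = (y - x) / x"
  define e where "e = min d 1"
  have y: "y = x + x * d" using assms by (simp add: d_def)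
  have d: "0 \<le> d" and e: "0 \<le> e" "e \<le> 1" "e \<le> d"
    using assms by (auto simp: d_def e_def)
  have "x * e = min (x * d) x" using \<open>0 < x\<close> by (auto simp: e_def min_def)
  then have xe: "x - max 0 (2 * x - y) = x * e" using y by auto
  have gain_mono: "e * ln (1 + e) + e / 2 * ln (1 + e / 2) \<le> d * ln (1 + d) + d / 2 * ln (1 + d / 2)"
    using d e by (intro add_mono mult_mono) auto
  have "6 * ln (3::real) = 2 * ln (3 ^ 3)" by (subst ln_realpow) simp_all
  also have "\<dots> \<le> 2 * ln (2 ^ 5 :: real)" by (intro mult_left_mono) simp_all
  also have "\<dots> = 10 * ln (2::real)" by (subst ln_realpow) simp_all
  finally have "3 / 4 * ln 3 \<le> 5 / 4 * ln (2::real)" by simp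
  then have "3 / 4 * ln 3 * e\<^sup>2 \<le> 5 / 4 * ln 2 * e\<^sup>2"
    by (rule mult_right_mono) simp
  also have "\<dots> = e * (e * ln 2) + e / 2 * (e / 2 * ln 2)"
    by (simp add: power2_eq_square)
  also have "\<dots> \<le> e * ln (1 + e) + e / 2 * ln (1 + e / 2)"
    using e by (intro add_mono mult_left_mono ln_one_plus_ge) auto
  finally have "3 / 4 * ln 3 * e\<^sup>2 \<le> d * ln (1 + d) + d / 2 * ln (1 + d / 2)"
    using gain_mono by linarith
  then have "x * (3 / 4 * ln 3 * e\<^sup>2) \<le> x * (d * ln (1 + d) + d / 2 * ln (1 + d / 2))"
    using \<open>0 < x\<close> by simp
  moreover have "3 / 2 * ln 3 / 2 * ((x * e)\<^sup>2 / x) = x * (3 / 4 * ln 3 * e\<^sup>2)"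
    using \<open>0 < x\<close> by (simp add: power2_eq_square)
  moreover have "x * (d * ln (1 + d) + d / 2 * ln (1 + d / 2))
      = ln (1 + d / 2) * (x * (d / 2)) + ln (1 + d) * (x * d)"
    by (simp add: algebra_simps)
  moreover have "(x + y) / 2 / x = 1 + d / 2" "y / x = 1 + d" "y - (x + y) / 2 = x * (d / 2)" "y - x = x * d"
    using \<open>0 < x\<close> by (simp_all add: y field_simps)
  ultimately show ?thesis
    unfolding xe by (simp only:)
qed

text \<open>
  The integral is \<open>m ln (y / m) + m - x\<close>, and \<open>ln (y / m) \<le> y / m - 1\<close>. For \<open>x = 0\<close> the integrand is
  unbounded at zero, but its primitive \<open>F\<close> extends continuously with \<open>F 0 = 0\<close>.
\<close>
lemma nn_integral_far_loss:
  assumes xy: "0 \<le> x" "3 * x < y" and m: "m = (x + y) / 2"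
  shows "(\<integral>\<^sup>+z. ennreal (if 0 \<le> z \<and> z \<le> m then ln (y / max x z) else 0) \<partial>lborel) \<le> ennreal (y - x)"
proof -
  have pos: "0 < m" "x \<le> m" "m < y" using assms by auto
  define F where "F z = z * ln y - z * ln z + z" for z
  have cont: "continuous_on {0..} F"
  proof -
    have "continuous_on {0..} (\<lambda>z::real. z * ln z)"
      unfolding continuous_on_def
    proof
      fix z :: real assume "z \<in> {0..}"
      show "((\<lambda>z. z * ln z) \<longlongrightarrow> z * ln z) (at z within {0..})"
      proof (cases "z = 0")
        case True
        have "((\<lambda>z::real. z * ln z) \<longlongrightarrow> 0) (at_right 0)" by real_asymp
        then show ?thesis using True by (simp add: at_within_Ici_at_right)
      next
        case False
        then show ?thesis by (intro tendsto_intros) auto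
      qed
    qed
    then show ?thesis unfolding F_def by (intro continuous_on_add continuous_on_diff continuous_on_mult_right continuous_on_id)
  qed
  have F: "F 0 = 0" by (simp add: F_def)
  have "((\<lambda>z. ln (y / z)) has_integral F m - F x) {x..m}"
  proof (rule fundamental_theorem_of_calculus_interior)
    show "continuous_on {x..m} F"
      using cont by (rule continuous_on_subset) (use xy in auto)
    show "(F has_vector_derivative ln (y / z)) (at z)" if "z \<in> {x<..<m}" for z
      unfolding has_real_derivative_iff_has_vector_derivative[symmetric] F_def
      using that xy by (auto intro!: derivative_eq_intros simp: ln_div)
  qed (use pos in auto)
  moreover have "0 \<le> ln (y / z)" if "z \<in> {x..m}" for z
    using that xy pos by (cases "z = 0") auto
  ultimately have int: "(\<integral>\<^sup>+z. ennreal (ln (y / z)) * indicator {x..m} z \<partial>lborel) = ennreal (F m - F x)"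
    by (intro nn_integral_has_integral_lebesgue')
  have lnx: "0 \<le> ln (y / x)" using xy by (cases "x = 0") auto
  have "(\<integral>\<^sup>+z. ennreal (if 0 \<le> z \<and> z \<le> m then ln (y / max x z) else 0) \<partial>lborel)
      \<le> (\<integral>\<^sup>+z. ennreal (ln (y / x)) * indicator {0..x} z + ennreal (ln (y / z)) * indicator {x..m} z \<partial>lborel)"
    using xy by (intro nn_integral_mono) (auto simp: indicator_def max_def)
  also have "\<dots> = (\<integral>\<^sup>+z. ennreal (ln (y / x)) * indicator {0..x} z \<partial>lborel) + ennreal (F m - F x)"
    unfolding int[symmetric] by (rule nn_integral_add) auto
  also have "(\<integral>\<^sup>+z. ennreal (ln (y / x)) * indicator {0..x} z \<partial>lborel) = ennreal (ln (y / x) * x)"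
    using xy lnx by (subst nn_integral_cmult_indicator) (auto simp: ennreal_mult)
  also have "ennreal (ln (y / x) * x) + ennreal (F m - F x) \<le> ennreal (y - x)"
  proof -
    have "0 \<le> F m - F x"
      using \<open>((\<lambda>z. ln (y / z)) has_integral F m - F x) {x..m}\<close> \<open>\<And>z. z \<in> {x..m} \<Longrightarrow> 0 \<le> ln (y / z)\<close>
      by (rule has_integral_nonneg)
    then have "ennreal (ln (y / x) * x) + ennreal (F m - F x) = ennreal (ln (y / x) * x + (F m - F x))"
      using lnx xy by (subst ennreal_plus) auto
    also have "\<dots> \<le> ennreal (y - x)"
    proof (rule ennreal_leI)
      have "ln (y / x) * x + (F m - F x) = m * ln (y / m) + m - x"
        using xy pos by (cases "x = 0") (auto simp: F_def ln_div algebra_simps)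
      also have "\<dots> \<le> m * (y / m - 1) + m - x"
        using pos xy by (auto intro!: mult_left_mono ln_le_minus_one)
      also have "\<dots> = y - x" using pos by (simp add: field_simps)
      finally show "ln (y / x) * x + (F m - F x) \<le> y - x" .
    qed
    finally show ?thesis .
  qed
  finally show ?thesis .
qed

lemma ln_3_ge_1: "1 \<le> ln (3::real)"
  using exp_le by (simp add: ln_ge_iff)

context nondecreasing_density
begin

text \<open>
  The supermartingale inequality for \<open>ln (3 / weight)\<close>, which is non-negative because the weight
  is at most 3. In the distant case the gain is \<open>ln 3 \<cdot> (y - x)\<close>, which beats the loss because
  \<open>ln 3 \<ge> 1\<close>: for this argument the constant in the weight has to be at least \<open>e\<close>.
\<close>
lemma expected_log_weight_drift:
  assumes xy: "0 \<le> x" "x \<le> y" "0 < y" "y \<le> 1" "2 * y < \<epsilon>"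
    and unit: "AE z in D. 0 < z \<and> z \<le> 1"
  shows "(\<integral>\<^sup>+z. ln (3 / next_weight_bound x y z) \<partial>D) \<le> ennreal (ln (3 / weight x y))"
proof -
  have w: "0 < weight x y" "weight x y \<le> 3" using xy by (auto simp: weight_def)
  have nonneg: "0 \<le> ln (3 / next_weight_bound x y z)" if "0 < z" "z \<le> 1" for z
  proof -
    have "next_weight_bound x y z \<le> 3"
      using that xy by (auto simp: next_weight_bound_def weight_def middle_def)
    then show ?thesis
      using next_weight_bound_pos[OF xy(1-3) that(1)] by simp
  qed
  show ?thesis
  proof (cases "y \<le> 3 * x")
    case True
    then have x: "0 < x" using xy by linarith
    let ?m = "(x + y) / 2"
    let ?c1 = "ln (?m / x)" and ?c2 = "ln (y / x)"
    have c: "0 \<le> ?c1" "0 \<le> ?c2" using x xy by auto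
    let ?gain = "\<lambda>z. if ?m < z \<and> z \<le> y then ?c1 else if y < z \<and> z < 2 * y - x then ?c2 else 0"
    have "(\<integral>\<^sup>+z. ennreal (?gain z) \<partial>lborel)
        = (\<integral>\<^sup>+z. ennreal ?c1 * indicator {?m<..y} z + ennreal ?c2 * indicator {y<..<2 * y - x} z \<partial>lborel)"
      by (intro nn_integral_cong) (auto simp: indicator_def)
    also have "\<dots> = ennreal ?c1 * emeasure lborel {?m<..y} + ennreal ?c2 * emeasure lborel {y<..<2 * y - x}"
      by (subst nn_integral_add) (auto simp: nn_integral_cmult_indicator)
    also have "\<dots> = ennreal (?c1 * (y - ?m) + ?c2 * (y - x))"
      using xy c by (simp add: ennreal_mult')
    finally have gain: "(\<integral>\<^sup>+z. ennreal (?gain z) \<partial>lborel) = ennreal (?c1 * (y - ?m) + ?c2 * (y - x))" .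
    show ?thesis
    proof (rule expectation_le_of_loss_le_gain[where m = ?m and gain = ?gain and K = "?c1 + ?c2"
          and loss = "\<lambda>z. if max 0 (2 * x - y) \<le> z \<and> z \<le> x then 3 / 2 * ln 3 * ((x - z) / x) else 0"])
      show "(\<integral>\<^sup>+z. ennreal (if max 0 (2 * x - y) \<le> z \<and> z \<le> x then 3 / 2 * ln 3 * ((x - z) / x) else 0) \<partial>lborel)
          \<le> (\<integral>\<^sup>+z. ennreal (?gain z) \<partial>lborel)"
        unfolding gain
      proof (subst nn_integral_linear_loss)
        show "ennreal (3 / 2 * ln 3 / 2 * ((x - max 0 (2 * x - y))\<^sup>2 / x))
            \<le> ennreal (?c1 * (y - ?m) + ?c2 * (y - x))"
          using near_loss_le_gain[OF x xy(2) True] by (rule ennreal_leI)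
      qed (use x xy in auto)
      show "AE z in D. 0 \<le> ln (3 / next_weight_bound x y z) \<and>
          ln (3 / next_weight_bound x y z) + ?gain z \<le> ln (3 / weight x y) +
            (if max 0 (2 * x - y) \<le> z \<and> z \<le> x then 3 / 2 * ln 3 * ((x - z) / x) else 0)"
        using unit by eventually_elim (use nonneg weight_le_bound_near[OF x xy(2) True] in blast)
      show "?gain z \<le> ?c1 + ?c2" for z
        using c by (simp only: split: if_split) linarith
    qed (use x xy c w in \<open>auto split: if_splits\<close>)
  next
    case False
    let ?m = "(x + y) / 2"
    let ?gain = "\<lambda>z. if y < z \<and> z < 2 * y - x then ln 3 else (0::real)"
    have "(\<integral>\<^sup>+z. ennreal (?gain z) \<partial>lborel) = (\<integral>\<^sup>+z. ennreal (ln 3) * indicator {y<..<2 * y - x} z \<partial>lborel)"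
      by (intro nn_integral_cong) (auto simp: indicator_def)
    also have "\<dots> = ennreal (ln 3 * (y - x))"
      using xy by (simp add: nn_integral_cmult_indicator ennreal_mult')
    finally have gain: "(\<integral>\<^sup>+z. ennreal (?gain z) \<partial>lborel) = ennreal (ln 3 * (y - x))" .
    show ?thesis
    proof (rule expectation_le_of_loss_le_gain[where m = ?m and gain = ?gain and K = "ln 3"
          and loss = "\<lambda>z. if 0 \<le> z \<and> z \<le> ?m then ln (y / max x z) else 0"])
      have "(\<integral>\<^sup>+z. ennreal (if 0 \<le> z \<and> z \<le> ?m then ln (y / max x z) else 0) \<partial>lborel) \<le> ennreal (y - x)"
        using False xy by (intro nn_integral_far_loss) auto
      also have "\<dots> \<le> ennreal (ln 3 * (y - x))"
        using ln_3_ge_1 xy mult_right_mono[of 1 "ln 3" "y - x"] by (intro ennreal_leI) auto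
      finally show "(\<integral>\<^sup>+z. ennreal (if 0 \<le> z \<and> z \<le> ?m then ln (y / max x z) else 0) \<partial>lborel)
          \<le> (\<integral>\<^sup>+z. ennreal (?gain z) \<partial>lborel)"
        by (simp only: gain)
      show "AE z in D. 0 \<le> ln (3 / next_weight_bound x y z) \<and>
          ln (3 / next_weight_bound x y z) + ?gain z \<le> ln (3 / weight x y) +
            (if 0 \<le> z \<and> z \<le> ?m then ln (y / max x z) else 0)"
        using unit by eventually_elim (use nonneg weight_le_bound_far[OF xy(1)] False in force)
      show "0 \<le> (if 0 \<le> z \<and> z \<le> ?m then ln (y / max x z) else 0)" for z
        using xy False by (cases "max x z = 0") auto
    qed (use xy w False in \<open>auto split: if_splits\<close>)
  qed
qed

end

section \<open>Independent chances repeated infinitely often\<close>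

text \<open>
  A conditional Borel--Cantelli lemma. Let \<open>Q t\<close> say that no success has occurred between \<open>N\<close> and
  \<open>t\<close>. Each visit of \<open>E t\<close> while \<open>Q t\<close> holds costs \<open>Q\<close> at least \<open>\<eta> * prob (Q t \<inter> E t)\<close> of
  its probability; these costs have a finite sum, so that almost surely \<open>Q t \<inter> E t\<close> occurs only
  finitely often. A path without success after \<open>N\<close> stays in \<open>Q\<close> and thus visits \<open>E\<close> finitely often.
\<close>
lemma (in prob_space) infinitely_often_hits:
  fixes F :: "nat \<Rightarrow> 'a measure" and E B :: "nat \<Rightarrow> 'a set"
  assumes F: "\<And>t. space (F t) = space M" "\<And>t. sets (F t) \<subseteq> events" "\<And>t. sets (F t) \<subseteq> sets (F (Suc t))"
    and E: "\<And>t. E t \<in> sets (F t)" and B: "\<And>t. B t \<in> sets (F (Suc t))"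
    and indep: "\<And>t A. A \<in> sets (F t) \<Longrightarrow> prob (A \<inter> B t) = prob A * prob (B t)"
    and \<eta>: "0 < \<eta>" "\<And>t. \<eta> \<le> prob (B t)"
  shows "AE \<omega> in M. (\<exists>\<^sub>\<infinity>t. \<omega> \<in> E t) \<longrightarrow> (\<exists>\<^sub>\<infinity>t. \<omega> \<in> E t \<inter> B t)"
proof -
  have F_mono: "sets (F s) \<subseteq> sets (F t)" if "s \<le> t" for s t
    using F(3) that by (rule lift_Suc_mono_le)
  have "AE \<omega> in M. (\<exists>\<^sub>\<infinity>t. \<omega> \<in> E t) \<longrightarrow> (\<exists>t\<ge>N. \<omega> \<in> E t \<inter> B t)" for N
  proof -
    define Q where "Q t = space M - (\<Union>s\<in>{N..<t}. E s \<inter> B s)" for t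
    have Q: "Q t \<in> sets (F t)" for t
    proof -
      have "E s \<inter> B s \<in> sets (F t)" if "s \<in> {N..<t}" for s
        using E[of s] B[of s] F_mono[of s t] F_mono[of "Suc s" t] that by auto
      then show ?thesis
        unfolding Q_def F(1)[of t, symmetric] by (intro sets.Diff sets.finite_UN) auto
    qed
    have QE: "Q t \<inter> E t \<in> sets (F t)" for t using Q E by auto
    have decrease: "\<eta> * prob (Q t \<inter> E t) \<le> prob (Q t) - prob (Q (Suc t))" if "N \<le> t" for t
    proof -
      have "Q (Suc t) = Q t - (Q t \<inter> E t \<inter> B t)"
        using that by (auto simp: Q_def less_Suc_eq)
      moreover have "Q t \<inter> E t \<inter> B t \<in> events"
        using QE[of t] B[of t] F(2) by blast
      ultimately have "prob (Q (Suc t)) = prob (Q t) - prob (Q t \<inter> E t \<inter> B t)"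
        using Q F(2) by (subst finite_measure_Diff[symmetric]) auto
      also have "prob (Q t \<inter> E t \<inter> B t) = prob (Q t \<inter> E t) * prob (B t)"
        using QE by (rule indep)
      finally show ?thesis
        using mult_right_mono[OF \<eta>(2)[of t], of "prob (Q t \<inter> E t)"] by (simp add: mult.commute)
    qed
    have "(\<Sum>t<n. \<eta> * prob (Q (t + N) \<inter> E (t + N))) \<le> prob (Q N) - prob (Q (n + N))" for n
    proof (induction n)
      case (Suc n)
      then show ?case using decrease[of "n + N"] by simp
    qed simp
    also have "prob (Q N) - prob (Q (n + N)) \<le> 1" for n
      using prob_le_1[of "Q N"] measure_nonneg[of M "Q (n + N)"] by linarith
    finally have "summable (\<lambda>t. \<eta> * prob (Q (t + N) \<inter> E (t + N)))"
      using \<eta>(1) by (intro bounded_imp_summable[where B = 1]) (auto simp: lessThan_Suc_atMost[symmetric] simp del: sum.lessThan_Suc)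
    then have "summable (\<lambda>t. prob (Q t \<inter> E t))"
      using \<eta>(1) by (simp add: summable_iff_shift[of "\<lambda>t. prob (Q t \<inter> E t)"])
    then have "AE \<omega> in M. eventually (\<lambda>t. \<omega> \<in> space M - Q t \<inter> E t) sequentially"
      using QE F(2) by (intro borel_cantelli_AE1) (auto simp: emeasure_eq_measure)
    then show ?thesis
    proof (rule AE_mp[OF _ AE_I2], intro impI)
      fix \<omega> assume "\<omega> \<in> space M" "eventually (\<lambda>t. \<omega> \<in> space M - Q t \<inter> E t) sequentially"
        and "\<exists>\<^sub>\<infinity>t. \<omega> \<in> E t"
      then have "\<exists>\<^sub>\<infinity>t. \<omega> \<in> E t \<and> \<omega> \<in> space M - Q t \<inter> E t"
        unfolding cofinite_eq_sequentially by (intro frequently_eventually_frequently)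
      then obtain t where "\<omega> \<in> E t \<and> \<omega> \<in> space M - Q t \<inter> E t"
        by (rule INFM_E)
      then have "\<omega> \<in> E t" "\<omega> \<notin> Q t" by auto
      with \<open>\<omega> \<in> space M\<close> show "\<exists>t\<ge>N. \<omega> \<in> E t \<inter> B t"
        by (auto simp: Q_def)
    qed
  qed
  then have "AE \<omega> in M. \<forall>N. (\<exists>\<^sub>\<infinity>t. \<omega> \<in> E t) \<longrightarrow> (\<exists>t\<ge>N. \<omega> \<in> E t \<inter> B t)"
    unfolding AE_all_countable by (rule allI)
  then show ?thesis
    by eventually_elim (auto simp: INFM_nat_le)
qed

section \<open>The contest as a Markov chain\<close>

locale three_point_contest = p_contest M 3 p D \<zeta> tie X
  for M :: "'w measure" and p D \<zeta> tie X +
  assumes p_gt_1: "1 < p"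
begin

definition lo :: "nat \<Rightarrow> 'w \<Rightarrow> real" where
  "lo t \<omega> = order_point (core p (tie t \<omega>) (X t \<omega>)) 1"

definition hi :: "nat \<Rightarrow> 'w \<Rightarrow> real" where
  "hi t \<omega> = order_point (core p (tie t \<omega>) (X t \<omega>)) 2"

definition source_events :: "source \<Rightarrow> 'w set set" where
  "source_events s = (case s of
       Initial \<Rightarrow> sets (vimage_algebra (space M) (X 0) (configurations 3))
     | Sample t \<Rightarrow> sets (vimage_algebra (space M) (\<zeta> (Suc t)) borel)
     | Tie t \<Rightarrow> sets (vimage_algebra (space M) (tie t) (count_space UNIV)))"

text \<open>
  The core at time \<open>t\<close> depends on the samples \<open>\<zeta> 1, \<dots>, \<zeta> t\<close>, and \<open>Sample s\<close> stands for \<open>\<zeta> (Suc s)\<close>,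
  whereas the coin \<open>tie t\<close> is already used in the core at time \<open>t\<close>: hence the two different bounds.
\<close>
definition sources_until :: "nat \<Rightarrow> source set" where
  "sources_until t = insert Initial (Sample ` {..<t} \<union> Tie ` {..t})"

definition history :: "nat \<Rightarrow> 'w measure" where
  "history t = sigma (space M) (\<Union>s\<in>sources_until t. source_events s)"

lemma source_events_subset: "source_events s \<subseteq> events"
  using independent unfolding source_events_def indep_sets_def by blast

lemma source_events_Pow: "(\<Union>s\<in>S. source_events s) \<subseteq> Pow (space M)"
  using source_events_subset sets.space_closed[of M] by blast

lemma space_history [simp]: "space (history t) = space M"
  unfolding history_def by (rule space_measure_of[OF source_events_Pow])

lemma sets_history: "sets (history t) = sigma_sets (space M) (\<Union>s\<in>sources_until t. source_events s)"
  unfolding history_def by (rule sets_measure_of[OF source_events_Pow])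

lemma sets_history_subset: "sets (history t) \<subseteq> events"
  unfolding sets_history using source_events_subset
  by (intro sets.sigma_sets_subset) blast

lemma source_events_in_history: "s \<in> sources_until t \<Longrightarrow> source_events s \<subseteq> sets (history t)"
  unfolding sets_history by (blast intro: sigma_sets.Basic)

lemma sets_history_mono: "s \<le> t \<Longrightarrow> sets (history s) \<subseteq> sets (history t)"
  unfolding sets_history by (intro sigma_sets_mono') (auto simp: sources_until_def)

lemma measurable_history_mono: "f \<in> history s \<rightarrow>\<^sub>M S \<Longrightarrow> s \<le> t \<Longrightarrow> f \<in> history t \<rightarrow>\<^sub>M S"
  using sets_history_mono[of s t] by (auto simp: measurable_def)

text \<open>
  Disjoint sets of independent sources generate independent \<open>\<sigma>\<close>-algebras; a source that the history has
  not recorded is therefore independent of it.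
\<close>
lemma history_indep:
  assumes "s \<notin> sources_until t" "A \<in> sets (history t)" "B \<in> source_events s"
  shows "prob (A \<inter> B) = prob A * prob B"
proof -
  define I where "I = case_bool (sources_until t) {s}"
  have "indep_sets source_events UNIV"
    using independent by (simp add: source_events_def[abs_def])
  then have "indep_sets source_events (\<Union>j\<in>UNIV. I j)"
    by (rule indep_sets_mono_index[rotated]) auto
  then have "indep_sets (\<lambda>j. sigma_sets (space M) (\<Union>i\<in>I j. source_events i)) UNIV"
  proof (rule indep_sets_collect_sigma)
    show "Int_stable (source_events i)" for i
      by (auto simp: source_events_def split: source.split intro: sets.Int_stable)
    show "disjoint_family_on I UNIV"
      using assms(1) by (auto simp: disjoint_family_on_def I_def split: bool.splits)
  qed
  moreover have "A \<in> sigma_sets (space M) (\<Union>i\<in>I True. source_events i)"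
    using assms(2) by (simp add: sets_history I_def)
  moreover have "B \<in> sigma_sets (space M) (\<Union>i\<in>I False. source_events i)"
    using assms(3) by (auto simp: I_def)
  ultimately show ?thesis
    using indep_setsD[of _ UNIV UNIV "case_bool A B"] by (auto simp: UNIV_bool ac_simps split: bool.splits)
qed

lemma measurable_history_source:
  assumes "s \<in> sources_until t" "source_events s = sets (vimage_algebra (space M) f S)" "f \<in> space M \<rightarrow> space S"
  shows "f \<in> history t \<rightarrow>\<^sub>M S"
proof (rule measurableI)
  fix A assume "A \<in> sets S"
  then have "f -` A \<inter> space M \<in> source_events s"
    unfolding assms(2) by (rule in_vimage_algebra)
  then show "f -` A \<inter> space (history t) \<in> sets (history t)"
    using source_events_in_history[OF assms(1)] by auto
qed (use assms(3) in auto)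

lemma space_X0: "X 0 \<in> space M \<rightarrow> {X. size X = 3}"
  using measurable_space[OF initial_measurable] by (auto simp: configurations_def)

lemma X0_history: "X 0 \<in> history t \<rightarrow>\<^sub>M configurations 3"
  using space_X0 by (intro measurable_history_source[of Initial])
    (auto simp: sources_until_def source_events_def configurations_def)

lemma sample_history: "s \<le> t \<Longrightarrow> \<zeta> (Suc s) \<in> borel_measurable (history (Suc t))"
  by (intro measurable_history_source[of "Sample s"]) (auto simp: sources_until_def source_events_def)

lemma tie_history [measurable]: "tie t \<in> history t \<rightarrow>\<^sub>M count_space UNIV"
  by (intro measurable_history_source[of "Tie t"]) (auto simp: sources_until_def source_events_def)

lemma order_point_X0_history:
  assumes "i \<in> {1..3}"
  shows "(\<lambda>\<omega>. order_point (X 0 \<omega>) i) \<in> borel_measurable (history t)"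
proof -
  let ?f = "\<lambda>X. \<lambda>i\<in>{1..3}. order_point X i"
  have "?f \<in> configurations 3 \<rightarrow>\<^sub>M (\<Pi>\<^sub>M i\<in>{1..3}. borel)"
    unfolding configurations_def by (rule measurable_vimage_algebra1) (auto simp: space_PiM)
  from measurable_compose[OF X0_history this]
  have "(\<lambda>\<omega>. ?f (X 0 \<omega>)) \<in> history t \<rightarrow>\<^sub>M (\<Pi>\<^sub>M i\<in>{1..3}. borel)" .
  from measurable_compose[OF this measurable_component_singleton[OF assms]]
  show ?thesis using assms by simp
qed

lemma X0_sorted:
  assumes "\<omega> \<in> space M"
  obtains m c u where "m \<le> c" "c \<le> u" "X 0 \<omega> = {#m, c, u#}"
    "order_point (X 0 \<omega>) 1 = m" "order_point (X 0 \<omega>) 2 = c" "order_point (X 0 \<omega>) 3 = u"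
proof -
  let ?l = "sorted_list_of_multiset (X 0 \<omega>)"
  have "length ?l = 3"
    using space_X0 assms by (metis (mono_tags) Pi_iff mem_Collect_eq mset_sorted_list_of_multiset size_mset)
  then obtain m c u where l: "?l = [m, c, u]"
    by (auto simp: length_Suc_conv numeral_3_eq_3)
  moreover have "sorted ?l" by simp
  moreover have "X 0 \<omega> = mset ?l" by simp
  ultimately show ?thesis
    by (intro that[of m c u]) (auto simp: order_point_def)
qed

lemma core_step:
  assumes \<omega>: "\<omega> \<in> space M" and le: "lo t \<omega> \<le> hi t \<omega>"
    and core: "core p (tie t \<omega>) (X t \<omega>) = {#lo t \<omega>, hi t \<omega>#}"
  shows "lo (Suc t) \<omega> = next_lo p (tie (Suc t) \<omega>) (lo t \<omega>) (hi t \<omega>) (\<zeta> (Suc t) \<omega>)" (is ?lo)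
    and "hi (Suc t) \<omega> = next_hi p (tie (Suc t) \<omega>) (lo t \<omega>) (hi t \<omega>) (\<zeta> (Suc t) \<omega>)" (is ?hi)
    and "core p (tie (Suc t) \<omega>) (X (Suc t) \<omega>) = {#lo (Suc t) \<omega>, hi (Suc t) \<omega>#}" (is ?core)
proof -
  have "X (Suc t) \<omega> = {#\<zeta> (Suc t) \<omega>, lo t \<omega>, hi t \<omega>#}"
    using step[OF \<omega>, of t] core by simp
  then have core': "core p (tie (Suc t) \<omega>) (X (Suc t) \<omega>)
      = {#next_lo p (tie (Suc t) \<omega>) (lo t \<omega>) (hi t \<omega>) (\<zeta> (Suc t) \<omega>),
          next_hi p (tie (Suc t) \<omega>) (lo t \<omega>) (hi t \<omega>) (\<zeta> (Suc t) \<omega>)#}"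
    using le by (simp add: core_add_point)
  show ?lo ?hi ?core
    unfolding lo_def[of "Suc t"] hi_def[of "Suc t"] core'
    using le by (simp_all add: order_point_pair next_lo_le_next_hi)
qed

lemma core_eq:
  assumes "\<omega> \<in> space M"
  shows "lo t \<omega> \<le> hi t \<omega> \<and> core p (tie t \<omega>) (X t \<omega>) = {#lo t \<omega>, hi t \<omega>#}"
proof (induction t)
  case 0
  obtain m c u where "m \<le> c" "c \<le> u" "X 0 \<omega> = {#m, c, u#}"
    using X0_sorted[OF assms] by metis
  then show ?case
    by (simp add: lo_def hi_def core_sorted_triple order_point_pair)
next
  case (Suc t)
  then have *: "lo t \<omega> \<le> hi t \<omega>" "core p (tie t \<omega>) (X t \<omega>) = {#lo t \<omega>, hi t \<omega>#}" by auto
  show ?case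
    using core_step[OF assms *] next_lo_le_next_hi[OF *(1)] by simp
qed

lemma lo_le_hi: "\<omega> \<in> space M \<Longrightarrow> lo t \<omega> \<le> hi t \<omega>"
  using core_eq by blast

lemma
  assumes "\<omega> \<in> space M"
  shows lo_Suc: "lo (Suc t) \<omega> = next_lo p (tie (Suc t) \<omega>) (lo t \<omega>) (hi t \<omega>) (\<zeta> (Suc t) \<omega>)"
    and hi_Suc: "hi (Suc t) \<omega> = next_hi p (tie (Suc t) \<omega>) (lo t \<omega>) (hi t \<omega>) (\<zeta> (Suc t) \<omega>)"
  using core_step[OF assms] core_eq[OF assms] by blast+

lemma lo_hi_history_aux: "lo t \<in> borel_measurable (history t) \<and> hi t \<in> borel_measurable (history t)"
proof (induction t)
  case 0
  let ?o = "\<lambda>i \<omega>. order_point (X 0 \<omega>) i"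
  let ?r = "\<lambda>\<omega>. removes_min p (tie 0 \<omega>) (?o 1 \<omega>) (?o 2 \<omega>) (?o 3 \<omega>)"
  have [measurable]: "?o 1 \<in> borel_measurable (history 0)" "?o 2 \<in> borel_measurable (history 0)"
    "?o 3 \<in> borel_measurable (history 0)"
    by (simp_all add: order_point_X0_history)
  have eq: "lo 0 \<omega> = (if ?r \<omega> then ?o 2 \<omega> else ?o 1 \<omega>) \<and> hi 0 \<omega> = (if ?r \<omega> then ?o 3 \<omega> else ?o 2 \<omega>)"
    if \<omega>: "\<omega> \<in> space M" for \<omega>
  proof -
    obtain m c u where *: "m \<le> c" "c \<le> u" "X 0 \<omega> = {#m, c, u#}"
      and o: "?o 1 \<omega> = m" "?o 2 \<omega> = c" "?o 3 \<omega> = u"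
      using X0_sorted[OF \<omega>] by metis
    show ?thesis
      unfolding o unfolding lo_def hi_def *(3) core_sorted_triple[OF *(1,2)]
      using *(1,2) by (simp add: order_point_pair)
  qed
  let ?lo = "\<lambda>\<omega>. if ?r \<omega> then ?o 2 \<omega> else ?o 1 \<omega>" and ?hi = "\<lambda>\<omega>. if ?r \<omega> then ?o 3 \<omega> else ?o 2 \<omega>"
  have "?lo \<in> borel_measurable (history 0)" "?hi \<in> borel_measurable (history 0)"
    unfolding removes_min_def by measurable
  moreover have "lo 0 \<in> borel_measurable (history 0) \<longleftrightarrow> ?lo \<in> borel_measurable (history 0)"
    "hi 0 \<in> borel_measurable (history 0) \<longleftrightarrow> ?hi \<in> borel_measurable (history 0)"
    using eq by (intro measurable_cong; simp)+
  ultimately show ?case by blast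
next
  case (Suc t)
  have [measurable]: "lo t \<in> borel_measurable (history (Suc t))" "hi t \<in> borel_measurable (history (Suc t))"
    "\<zeta> (Suc t) \<in> borel_measurable (history (Suc t))"
    using Suc measurable_history_mono[of _ t borel "Suc t"] sample_history by auto
  let ?lo = "\<lambda>\<omega>. next_lo p (tie (Suc t) \<omega>) (lo t \<omega>) (hi t \<omega>) (\<zeta> (Suc t) \<omega>)"
    and ?hi = "\<lambda>\<omega>. next_hi p (tie (Suc t) \<omega>) (lo t \<omega>) (hi t \<omega>) (\<zeta> (Suc t) \<omega>)"
  have "?lo \<in> borel_measurable (history (Suc t))" "?hi \<in> borel_measurable (history (Suc t))"
    unfolding next_lo_def next_hi_def drops_min_def removes_min_def middle_def by measurable
  moreover have "lo (Suc t) \<in> borel_measurable (history (Suc t)) \<longleftrightarrow> ?lo \<in> borel_measurable (history (Suc t))"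
    "hi (Suc t) \<in> borel_measurable (history (Suc t)) \<longleftrightarrow> ?hi \<in> borel_measurable (history (Suc t))"
    by (intro measurable_cong; simp add: lo_Suc hi_Suc)+
  ultimately show ?case by blast
qed

lemma lo_history: "s \<le> t \<Longrightarrow> lo s \<in> borel_measurable (history t)"
  and hi_history: "s \<le> t \<Longrightarrow> hi s \<in> borel_measurable (history t)"
  using lo_hi_history_aux by (auto intro: measurable_history_mono)

end

section \<open>Almost sure properties of the paths\<close>

locale admissible_contest = three_point_contest M p D \<zeta> tie X
  for M :: "'w measure" and p D \<zeta> tie X +
  assumes full_support: "full_support D"
    and density_near_zero: "nondecreasing_density_near_zero D"
    and not_two_zeros: "p < 3 / 2 \<Longrightarrow> AE \<omega> in M. count (X 0 \<omega>) 0 < 2"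
begin

lemma sets_D [measurable_cong, simp]: "sets D = sets borel" and space_D [simp]: "space D = UNIV"
  using sample_distribution[of 0] by (auto simp flip: sample_distribution[of 0])

lemma prob_space_D: "prob_space D"
  using prob_space_distr[OF sample_measurable[of 0]] by (simp add: sample_distribution)

lemma AE_sample: "(AE z in D. P z) \<Longrightarrow> AE \<omega> in M. P (\<zeta> (Suc t) \<omega>)"
  using AE_distrD[OF sample_measurable[of t], of P] unfolding sample_distribution .

lemma nondecreasing_density_D:
  obtains f \<epsilon> where "0 < \<epsilon>" "nondecreasing_density D f \<epsilon>"
proof -
  obtain \<epsilon> f where *: "0 < \<epsilon>" "f \<in> borel_measurable borel" "mono_on {0..<\<epsilon>} f"
    "\<forall>A\<in>sets borel. A \<subseteq> {0..<\<epsilon>} \<longrightarrow> emeasure D A = (\<integral>\<^sup>+x\<in>A. ennreal (f x) \<partial>lborel)"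
    using density_near_zero unfolding nondecreasing_density_near_zero_def by auto
  interpret D: prob_space D by (rule prob_space_D)
  have "nondecreasing_density D f \<epsilon>"
    by unfold_locales (use * in auto)
  then show ?thesis using that * by blast
qed

lemma AE_D_unit: "AE z in D. 0 < z \<and> z \<le> 1"
proof -
  interpret D: prob_space D by (rule prob_space_D)
  obtain f \<epsilon> where \<epsilon>: "0 < \<epsilon>" and "nondecreasing_density D f \<epsilon>"
    by (rule nondecreasing_density_D)
  then interpret nondecreasing_density D f \<epsilon> by blast
  have "emeasure D {0} = (\<integral>\<^sup>+z\<in>{0}. ennreal (f z) \<partial>lborel)"
    using \<epsilon> by (intro emeasure_near_zero) auto
  also have "\<dots> = 0"
    by (subst nn_integral_0_iff_AE) (use AE_lborel_singleton[of 0] in \<open>auto simp: indicator_def\<close>)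
  finally have "AE z in D. z \<noteq> 0"
    by (intro AE_I[where N = "{0}"]) auto
  moreover have "AE z in D. z \<in> {0..1}"
    using sample_in_unit_interval by (intro D.AE_prob_1) auto
  ultimately show ?thesis by eventually_elim auto
qed

lemma topological_support_unit: "topological_support D \<subseteq> {0..1}"
proof
  interpret D: prob_space D by (rule prob_space_D)
  fix x assume x: "x \<in> topological_support D"
  have null: "emeasure D (- {0..1}) = 0"
    using D.prob_compl[of "{0..1}"] sample_in_unit_interval
    by (simp add: D.emeasure_eq_measure Compl_eq_Diff_UNIV)
  show "x \<in> {0..1}"
  proof (rule ccontr)
    assume "x \<notin> {0..1}"
    moreover have "open (- {0..1::real})" by (rule open_Compl) simp
    ultimately have "0 < emeasure D (- {0..1})"
      using x unfolding topological_support_def by blast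
    with null show False by simp
  qed
qed

text \<open>
  Almost every path satisfies these bounds. A new point is never zero, because \<open>D\<close> has a density
  there; therefore a core that has left \<open>{0, 0}\<close> never returns to it.
\<close>
definition regular :: "'w \<Rightarrow> bool" where
  "regular \<omega> \<longleftrightarrow> \<omega> \<in> space M \<and> set_mset (X 0 \<omega>) \<subseteq> {0..1} \<and>
     (\<forall>t. 0 < \<zeta> (Suc t) \<omega> \<and> \<zeta> (Suc t) \<omega> \<le> 1)"

lemma AE_regular: "AE \<omega> in M. regular \<omega>"
proof -
  have "AE \<omega> in M. \<forall>t. 0 < \<zeta> (Suc t) \<omega> \<and> \<zeta> (Suc t) \<omega> \<le> 1"
    unfolding AE_all_countable using AE_sample[OF AE_D_unit] by blast
  with initial_in_support AE_space show ?thesis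
    by eventually_elim (use topological_support_unit in \<open>auto simp: regular_def\<close>)
qed

lemma regularD:
  assumes "regular \<omega>"
  shows "\<omega> \<in> space M" "0 < \<zeta> (Suc t) \<omega>" "\<zeta> (Suc t) \<omega> \<le> 1"
  using assms by (auto simp: regular_def)

lemma core_in_unit:
  assumes "regular \<omega>"
  shows "0 \<le> lo t \<omega>" "hi t \<omega> \<le> 1"
proof -
  have "0 \<le> lo t \<omega> \<and> hi t \<omega> \<le> 1"
  proof (induction t)
    case 0
    have "core p (tie 0 \<omega>) (X 0 \<omega>) \<subseteq># X 0 \<omega>" by (simp add: core_def)
    then have "set_mset {#lo 0 \<omega>, hi 0 \<omega>#} \<subseteq> set_mset (X 0 \<omega>)"
      using core_eq[of \<omega> 0] regularD(1)[OF assms] by (metis set_mset_mono)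
    then show ?case using assms by (auto simp: regular_def)
  next
    case (Suc t)
    have \<omega>: "\<omega> \<in> space M" using assms by (rule regularD)
    then show ?case
      using Suc next_between(1,2)[OF lo_le_hi[OF \<omega>, of t], where p = p and b = "tie (Suc t) \<omega>" and z = "\<zeta> (Suc t) \<omega>"]
        regularD(2,3)[OF assms, of t]
      by (simp add: lo_Suc hi_Suc min_def max_def split: if_splits)
  qed
  then show "0 \<le> lo t \<omega>" "hi t \<omega> \<le> 1" by auto
qed

lemma hi_Suc_pos:
  assumes "regular \<omega>" "0 < hi t \<omega>"
  shows "0 < hi (Suc t) \<omega>"
  using assms core_in_unit[OF assms(1), of t] regularD(1,2)[OF assms(1)] lo_le_hi[of \<omega> t]
  by (simp add: hi_Suc next_hi_pos)

lemma hi_pos_mono: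
  assumes "regular \<omega>" "0 < hi s \<omega>" "s \<le> t"
  shows "0 < hi t \<omega>"
  using assms(3,2) by (induction rule: dec_induct) (auto intro: hi_Suc_pos[OF assms(1)])

text \<open>
  For \<open>p < 3 / 2\<close> the initial core is not \<open>{0, 0}\<close> by assumption; for larger \<open>p\<close> that core is left as
  soon as a coin shows true.
\<close>
lemma AE_hi_eventually_pos: "AE \<omega> in M. \<exists>t. 0 < hi t \<omega>"
proof (cases "p < 3 / 2")
  case True
  from not_two_zeros[OF True] AE_regular show ?thesis
  proof eventually_elim
    case (elim \<omega>)
    have "count (core p (tie 0 \<omega>) (X 0 \<omega>)) 0 \<le> count (X 0 \<omega>) 0"
      by (simp add: core_def)
    then have "lo 0 \<omega> \<noteq> 0 \<or> hi 0 \<omega> \<noteq> 0"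
      using elim core_eq[of \<omega> 0] regularD(1)[of \<omega>] by auto
    then have "0 < hi 0 \<omega>"
      using core_in_unit[of \<omega> 0] lo_le_hi[of \<omega> 0] regularD(1)[of \<omega>] elim by auto
    then show ?case by blast
  qed
next
  case False
  have "AE \<omega> in M. (\<exists>\<^sub>\<infinity>t::nat. \<omega> \<in> space M) \<longrightarrow> (\<exists>\<^sub>\<infinity>t. \<omega> \<in> space M \<inter> {\<omega> \<in> space M. tie (Suc t) \<omega>})"
  proof (rule infinitely_often_hits[where F = history and E = "\<lambda>_. space M" and \<eta> = "1 / 2"])
    show "{\<omega> \<in> space M. tie (Suc t) \<omega>} \<in> sets (history (Suc t))" for t
      using measurable_sets[OF tie_history[of "Suc t"], of "{True}"] by (simp add: vimage_def Int_def conj_commute)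
    have "{\<omega> \<in> space M. tie (Suc t) \<omega>} \<in> source_events (Tie (Suc t))" for t
      using in_vimage_algebra[of "{True}" "count_space UNIV" "tie (Suc t)" "space M"]
      by (simp add: source_events_def vimage_def Int_def conj_commute)
    then show "prob (A \<inter> {\<omega> \<in> space M. tie (Suc t) \<omega>}) = prob A * prob {\<omega> \<in> space M. tie (Suc t) \<omega>}"
      if "A \<in> sets (history t)" for t A
      using that by (intro history_indep[of "Tie (Suc t)" t]) (auto simp: sources_until_def)
    show "space M \<in> sets (history t)" for t
      using sets.top[of "history t"] by simp
  qed (use sets_history_subset sets_history_mono[OF le_SucI[OF order_refl]] tie_fair in auto)
  with AE_regular show ?thesis
  proof eventually_elim
    case (elim \<omega>)
    then obtain t where t: "tie (Suc t) \<omega>"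
      using regularD(1)[of \<omega>] by (auto dest: INFM_EX)
    show ?case
    proof (cases "0 < hi t \<omega>")
      case False
      then have "lo t \<omega> = 0" "hi t \<omega> = 0"
        using core_in_unit[of \<omega> t] lo_le_hi[of \<omega> t] regularD(1)[of \<omega>] elim by auto
      then have "hi (Suc t) \<omega> = \<zeta> (Suc t) \<omega>"
        using t hi_Suc[of \<omega> t] regularD(1,2)[of \<omega>] elim \<open>\<not> p < 3 / 2\<close>
        by (simp add: next_hi_pos_of_zeros)
      then show ?thesis using regularD(2)[of \<omega> t] elim by metis
    qed blast
  qed
qed

text \<open>
  Whatever situation recurs infinitely often is infinitely often followed by a new point in any
  prescribed interval. This reduces the behaviour away from zero to single deterministic steps.
\<close>
lemma infinitely_often_sample_in:
  assumes ab: "0 \<le> a" "a < b" "b \<le> 1" and P: "\<And>t. {\<omega> \<in> space M. P t \<omega>} \<in> sets (history t)"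
  shows "AE \<omega> in M. (\<exists>\<^sub>\<infinity>t. P t \<omega>) \<longrightarrow> (\<exists>\<^sub>\<infinity>t. P t \<omega> \<and> \<zeta> (Suc t) \<omega> \<in> {a<..<b})"
proof -
  let ?B = "\<lambda>t. \<zeta> (Suc t) -` {a<..<b} \<inter> space M"
  have "AE \<omega> in M. (\<exists>\<^sub>\<infinity>t. \<omega> \<in> {\<omega> \<in> space M. P t \<omega>}) \<longrightarrow> (\<exists>\<^sub>\<infinity>t. \<omega> \<in> {\<omega> \<in> space M. P t \<omega>} \<inter> ?B t)"
  proof (rule infinitely_often_hits[where F = history and \<eta> = "measure D {a<..<b}"])
    show "?B t \<in> sets (history (Suc t))" for t
      using measurable_sets[OF sample_history[of t t], of "{a<..<b}"] by simp
    have "?B t \<in> source_events (Sample t)" for t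
      by (simp add: source_events_def in_vimage_algebra)
    then show "prob (A \<inter> ?B t) = prob A * prob (?B t)" if "A \<in> sets (history t)" for t A
      using that by (intro history_indep[of "Sample t" t]) (auto simp: sources_until_def)
    show "measure D {a<..<b} \<le> prob (?B t)" for t
      using measure_distr[OF sample_measurable[of t], of "{a<..<b}"] by (simp add: sample_distribution)
    show "0 < measure D {a<..<b}"
      using full_support ab by (auto simp: full_support_def)
  qed (use sets_history_subset sets_history_mono[OF le_SucI[OF order_refl]] P in auto)
  with AE_space show ?thesis
    by eventually_elim simp
qed

text \<open>
  The new point is independent of the history, so the identity map into the \<open>\<sigma>\<close>-algebra of the
  history and the new point have a product distribution; Fubini's theorem then plays the role of
  conditioning on the past.
\<close>
lemma nn_integral_freeze_history:
  assumes g: "g \<in> borel_measurable (history t \<Otimes>\<^sub>M borel)"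
  shows "(\<integral>\<^sup>+\<omega>. g (\<omega>, \<zeta> (Suc t) \<omega>) \<partial>M) = (\<integral>\<^sup>+\<omega>. \<integral>\<^sup>+z. g (\<omega>, z) \<partial>D \<partial>M)"
proof -
  interpret D: prob_space D by (rule prob_space_D)
  have id: "(\<lambda>\<omega>. \<omega>) \<in> M \<rightarrow>\<^sub>M history t"
    using sets_history_subset[of t] by (auto simp: measurable_def)
  interpret H: prob_space "distr M (history t) (\<lambda>\<omega>. \<omega>)"
    using id by (rule prob_space_distr)
  have pair: "distr M (history t) (\<lambda>\<omega>. \<omega>) \<Otimes>\<^sub>M D
      = distr M (history t \<Otimes>\<^sub>M borel) (\<lambda>\<omega>. (\<omega>, \<zeta> (Suc t) \<omega>))"
  proof (rule pair_measure_eqI)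
    show "sigma_finite_measure (distr M (history t) (\<lambda>\<omega>. \<omega>))" "sigma_finite_measure D"
      by unfold_locales
    show "sets (distr M (history t) (\<lambda>\<omega>. \<omega>) \<Otimes>\<^sub>M D)
        = sets (distr M (history t \<Otimes>\<^sub>M borel) (\<lambda>\<omega>. (\<omega>, \<zeta> (Suc t) \<omega>)))"
      by (simp cong: sets_pair_measure_cong)
    fix A B assume "A \<in> sets (distr M (history t) (\<lambda>\<omega>. \<omega>))" "B \<in> sets D"
    then have A: "A \<in> sets (history t)" and B: "B \<in> sets borel" by auto
    let ?B = "\<zeta> (Suc t) -` B \<inter> space M"
    have "emeasure (distr M (history t) (\<lambda>\<omega>. \<omega>)) A * emeasure D B = emeasure M A * emeasure M ?B"
      using A B id sample_measurable[of t] sets.sets_into_space[OF A]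
      by (simp add: emeasure_distr sample_distribution[of t, symmetric] Int_absorb2)
    also have "\<dots> = ennreal (prob A * prob ?B)"
      by (simp add: emeasure_eq_measure ennreal_mult)
    also have "prob A * prob ?B = prob (A \<inter> ?B)"
      using A B by (intro history_indep[symmetric, of "Sample t" t])
        (auto simp: sources_until_def source_events_def intro: in_vimage_algebra)
    also have "ennreal \<dots> = emeasure M ((\<lambda>\<omega>. (\<omega>, \<zeta> (Suc t) \<omega>)) -` (A \<times> B) \<inter> space M)"
      unfolding emeasure_eq_measure[symmetric]
      using sets.sets_into_space[OF A] by (intro arg_cong[where f = "emeasure M"]) auto
    also have "\<dots> = emeasure (distr M (history t \<Otimes>\<^sub>M borel) (\<lambda>\<omega>. (\<omega>, \<zeta> (Suc t) \<omega>))) (A \<times> B)"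
      using A B id sample_measurable[of t] by (intro emeasure_distr[symmetric]) auto
    finally show "emeasure (distr M (history t) (\<lambda>\<omega>. \<omega>)) A * emeasure D B
        = emeasure (distr M (history t \<Otimes>\<^sub>M borel) (\<lambda>\<omega>. (\<omega>, \<zeta> (Suc t) \<omega>))) (A \<times> B)" .
  qed
  have g': "g \<in> borel_measurable (distr M (history t) (\<lambda>\<omega>. \<omega>) \<Otimes>\<^sub>M D)"
    using g by (simp cong: measurable_cong_sets sets_pair_measure_cong)
  have "(\<integral>\<^sup>+\<omega>. g (\<omega>, \<zeta> (Suc t) \<omega>) \<partial>M)
      = (\<integral>\<^sup>+w. g w \<partial>distr M (history t \<Otimes>\<^sub>M borel) (\<lambda>\<omega>. (\<omega>, \<zeta> (Suc t) \<omega>)))"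
    using id sample_measurable[of t] g by (intro nn_integral_distr[symmetric]) auto
  also have "\<dots> = (\<integral>\<^sup>+\<omega>. \<integral>\<^sup>+z. g (\<omega>, z) \<partial>D \<partial>distr M (history t) (\<lambda>\<omega>. \<omega>))"
    unfolding pair[symmetric] by (rule D.nn_integral_fst[symmetric, OF g'])
  also have "\<dots> = (\<integral>\<^sup>+\<omega>. \<integral>\<^sup>+z. g (\<omega>, z) \<partial>D \<partial>M)"
  proof (rule nn_integral_distr[OF id])
    show "(\<lambda>\<omega>. \<integral>\<^sup>+z. g (\<omega>, z) \<partial>D) \<in> borel_measurable (distr M (history t) (\<lambda>\<omega>. \<omega>))"
      by (rule D.borel_measurable_nn_integral_fst[OF g'])
  qed
  finally show ?thesis .
qed

section \<open>Escaping from zero\<close>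

lemma weight_le_three_hi: "\<omega> \<in> space M \<Longrightarrow> regular \<omega> \<Longrightarrow> weight (lo t \<omega>) (hi t \<omega>) \<le> 3 * hi t \<omega>"
  using lo_le_hi[of \<omega> t] core_in_unit[of \<omega> t] by (auto simp: weight_def)

text \<open>
  Suppose that the core stays below \<open>\<epsilon> / 2\<close> from time \<open>T\<close> on. Then \<open>V\<close>, killed when the core leaves
  this region, is a non-negative supermartingale, and its expectation is bounded once the weight at time
  \<open>T\<close> is at least \<open>\<kappa> > 0\<close>. By Fatou's lemma it cannot tend to infinity, which it would do if the core
  tended to zero. The half of \<open>\<epsilon>\<close> keeps \<open>2 y - x\<close> within the range of the density.
\<close>
lemma AE_hi_not_tendsto_0: "AE \<omega> in M. \<not> (\<lambda>t. hi t \<omega>) \<longlonglongrightarrow> 0"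
proof -
  interpret D: prob_space D by (rule prob_space_D)
  obtain f \<epsilon> where \<epsilon>: "0 < \<epsilon>" and "nondecreasing_density D f \<epsilon>"
    by (rule nondecreasing_density_D)
  then interpret nondecreasing_density D f \<epsilon> by blast
  define V where "V t \<omega> = ennreal (ln (3 / weight (lo t \<omega>) (hi t \<omega>)))" for t \<omega>
  have lo_hi_measurable [measurable]: "lo t \<in> borel_measurable (history t)" "hi t \<in> borel_measurable (history t)" for t
    by (simp_all add: lo_history hi_history)
  have V_measurable [measurable]: "V t \<in> borel_measurable (history t)" for t
    unfolding V_def weight_def by measurable
  have "AE \<omega> in M. \<kappa> \<le> weight (lo T \<omega>) (hi T \<omega>) \<longrightarrow> (\<forall>t\<ge>T. hi t \<omega> < \<epsilon> / 2) \<longrightarrow> \<not> (\<lambda>t. hi t \<omega>) \<longlonglongrightarrow> 0"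
    if \<kappa>: "0 < \<kappa>" for \<kappa> T
  proof -
    define A where "A t = {\<omega> \<in> space M. \<kappa> \<le> weight (lo T \<omega>) (hi T \<omega>) \<and> (\<forall>s\<in>{T..t}. hi s \<omega> < \<epsilon> / 2)}" for t
    have A [measurable]: "A t \<in> sets (history t)" if "T \<le> t" for t
    proof -
      have [measurable]: "lo T \<in> borel_measurable (history t)" "hi T \<in> borel_measurable (history t)"
        using that by (auto intro: lo_history hi_history)
      have [measurable]: "Measurable.pred (history t) (\<lambda>\<omega>. hi s \<omega> < \<epsilon> / 2)" if "s \<in> {T..t}" for s
      proof -
        have [measurable]: "hi s \<in> borel_measurable (history t)" using that by (auto intro: hi_history)
        show ?thesis by measurable
      qed
      have "{\<omega> \<in> space (history t). \<kappa> \<le> weight (lo T \<omega>) (hi T \<omega>) \<and> (\<forall>s\<in>{T..t}. hi s \<omega> < \<epsilon> / 2)} \<in> sets (history t)"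
        unfolding weight_def by measurable
      then show ?thesis by (simp add: A_def)
    qed
    define a where "a n = (\<integral>\<^sup>+\<omega>. V (T + n) \<omega> * indicator (A (T + n)) \<omega> \<partial>M)" for n
    have hi_pos: "0 < hi t \<omega>" if "\<omega> \<in> A s" "regular \<omega>" "T \<le> t" for \<omega> s t
    proof (rule hi_pos_mono[OF that(2) _ that(3)])
      have "\<omega> \<in> space M" "0 < weight (lo T \<omega>) (hi T \<omega>)" using that(1) \<kappa> by (auto simp: A_def)
      then show "0 < hi T \<omega>" using lo_le_hi[of \<omega> T] by (auto simp: weight_def)
    qed
    have "a (Suc n) \<le> a n" for n
    proof -
      let ?t = "T + n"
      let ?h = "\<lambda>\<omega> z. indicator (A ?t) \<omega> * ennreal (ln (3 / next_weight_bound (lo ?t \<omega>) (hi ?t \<omega>) z))"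
      have "a (Suc n) \<le> (\<integral>\<^sup>+\<omega>. ?h \<omega> (\<zeta> (Suc ?t) \<omega>) \<partial>M)"
        unfolding a_def
      proof (rule nn_integral_mono_AE)
        show "AE \<omega> in M. V (T + Suc n) \<omega> * indicator (A (T + Suc n)) \<omega> \<le> ?h \<omega> (\<zeta> (Suc ?t) \<omega>)"
          using AE_regular
        proof eventually_elim
          case (elim \<omega>)
          show ?case
          proof (cases "\<omega> \<in> A (T + Suc n)")
            case True
            then have At: "\<omega> \<in> A ?t" and \<omega>: "\<omega> \<in> space M" by (auto simp: A_def)
            have x: "0 \<le> lo ?t \<omega>" "lo ?t \<omega> \<le> hi ?t \<omega>" "0 < hi ?t \<omega>"
              using core_in_unit[OF elim] lo_le_hi[OF \<omega>] hi_pos[OF At elim] by auto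
            have z: "0 < \<zeta> (Suc ?t) \<omega>" using elim by (rule regularD)
            let ?w = "next_weight_bound (lo ?t \<omega>) (hi ?t \<omega>) (\<zeta> (Suc ?t) \<omega>)"
            have w: "0 < ?w" "?w \<le> weight (lo (Suc ?t) \<omega>) (hi (Suc ?t) \<omega>)"
              using next_weight_bound_pos[OF x z] next_weight_bound_le[OF p_gt_1 x, of "\<zeta> (Suc ?t) \<omega>"] z
              by (auto simp: lo_Suc[OF \<omega>] hi_Suc[OF \<omega>])
            then have "ln (3 / weight (lo (Suc ?t) \<omega>) (hi (Suc ?t) \<omega>)) \<le> ln (3 / ?w)"
              by (subst ln_le_cancel_iff) (auto intro!: divide_left_mono mult_pos_pos)
            then show ?thesis
              using True At by (auto simp: V_def intro: ennreal_leI)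
          qed simp
        qed
      qed
      also have "\<dots> = (\<integral>\<^sup>+\<omega>. \<integral>\<^sup>+z. ?h \<omega> z \<partial>D \<partial>M)"
      proof -
        have "(\<lambda>(\<omega>, z). ?h \<omega> z) \<in> borel_measurable (history ?t \<Otimes>\<^sub>M borel)" by measurable
        from nn_integral_freeze_history[OF this] show ?thesis by simp
      qed
      also have "\<dots> \<le> a n"
        unfolding a_def
      proof (rule nn_integral_mono_AE)
        show "AE \<omega> in M. (\<integral>\<^sup>+z. ?h \<omega> z \<partial>D) \<le> V ?t \<omega> * indicator (A ?t) \<omega>"
          using AE_regular
        proof eventually_elim
          case (elim \<omega>)
          show ?case
          proof (cases "\<omega> \<in> A ?t")
            case True
            then have "\<omega> \<in> space M" "hi ?t \<omega> < \<epsilon> / 2" by (auto simp: A_def)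
            then have "(\<integral>\<^sup>+z. ln (3 / next_weight_bound (lo ?t \<omega>) (hi ?t \<omega>) z) \<partial>D) \<le> V ?t \<omega>"
              unfolding V_def
              using core_in_unit[OF elim] lo_le_hi hi_pos[OF True elim] AE_D_unit
              by (intro expected_log_weight_drift) auto
            then show ?thesis using True by simp
          qed simp
        qed
      qed
      finally show ?thesis .
    qed
    then have "a n \<le> a 0" for n
      by (induction n) (auto intro: order_trans)
    moreover have "a 0 \<le> ennreal (ln (3 / \<kappa>))"
    proof -
      have "a 0 \<le> (\<integral>\<^sup>+\<omega>. ennreal (ln (3 / \<kappa>)) \<partial>M)"
        unfolding a_def
      proof (rule nn_integral_mono)
        fix \<omega>
        show "V (T + 0) \<omega> * indicator (A (T + 0)) \<omega> \<le> ennreal (ln (3 / \<kappa>))"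
        proof (cases "\<omega> \<in> A T")
          case True
          then have w: "\<kappa> \<le> weight (lo T \<omega>) (hi T \<omega>)" by (auto simp: A_def)
          with \<kappa> have "ln (3 / weight (lo T \<omega>) (hi T \<omega>)) \<le> ln (3 / \<kappa>)"
            by (subst ln_le_cancel_iff) (auto intro!: divide_left_mono mult_pos_pos)
          then show ?thesis by (auto simp: V_def indicator_def intro: ennreal_leI)
        qed simp
      qed
      then show ?thesis by (simp add: emeasure_space_1)
    qed
    ultimately have a_le: "a n \<le> ennreal (ln (3 / \<kappa>))" for n
      using order_trans by blast
    let ?u = "\<lambda>n \<omega>. V (T + n) \<omega> * indicator (A (T + n)) \<omega>"
    have u [measurable]: "?u n \<in> borel_measurable M" for n
    proof -
      have "?u n \<in> borel_measurable (history (T + n))" by measurable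
      then show ?thesis using sets_history_subset[of "T + n"] by (auto simp: measurable_def)
    qed
    \<comment> \<open>Fatou: \<open>V\<close> cannot tend to infinity while the path stays in the sets \<open>A\<close>.\<close>
    have "(\<integral>\<^sup>+\<omega>. liminf (\<lambda>n. ?u n \<omega>) \<partial>M) \<le> liminf a"
      unfolding a_def by (rule nn_integral_liminf) measurable
    also have "\<dots> \<le> liminf (\<lambda>n. ennreal (ln (3 / \<kappa>)))"
      using a_le by (intro Liminf_mono) auto
    also have "\<dots> < \<infinity>" by (simp add: Liminf_const)
    finally have "AE \<omega> in M. liminf (\<lambda>n. ?u n \<omega>) \<noteq> \<infinity>"
      by (intro nn_integral_PInf_AE) auto
    with AE_regular show ?thesis
    proof eventually_elim
      case (elim \<omega>)
      have \<omega>: "\<omega> \<in> space M" using elim(1) by (rule regularD)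
      show ?case
      proof (intro impI notI)
        assume start: "\<kappa> \<le> weight (lo T \<omega>) (hi T \<omega>)" and small: "\<forall>t\<ge>T. hi t \<omega> < \<epsilon> / 2"
          and lim: "(\<lambda>t. hi t \<omega>) \<longlonglongrightarrow> 0"
        have in_A: "\<omega> \<in> A (T + n)" for n using start small \<omega> by (auto simp: A_def)
        have "\<infinity> \<le> liminf (\<lambda>n. ?u n \<omega>)"
          unfolding le_Liminf_iff
        proof (intro allI impI)
          \<comment> \<open>\<open>weight \<le> 3 hi < 3 exp (- (r + 1))\<close> eventually, which makes the logarithm exceed \<open>r\<close>.\<close>
          fix y :: ennreal assume "y < \<infinity>"
          then obtain r where r: "0 \<le> r" "y = ennreal r" by (cases y) auto
          have "eventually (\<lambda>n. hi (T + n) \<omega> < exp (- (r + 1))) sequentially"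
            using LIMSEQ_ignore_initial_segment[OF lim, of T] by (intro order_tendstoD(2)[where y = 0]) (auto simp: add.commute)
          then show "eventually (\<lambda>n. y < ?u n \<omega>) sequentially"
          proof eventually_elim
            case (elim n)
            let ?w = "weight (lo (T + n) \<omega>) (hi (T + n) \<omega>)"
            have "0 < hi (T + n) \<omega>" using hi_pos[OF in_A \<open>regular \<omega>\<close>] by simp
            then have "0 < ?w" by (auto simp: weight_def)
            moreover have "?w < 3 / exp (r + 1)"
              using weight_le_three_hi[OF \<omega> \<open>regular \<omega>\<close>, of "T + n"] elim
              unfolding exp_minus divide_inverse by linarith
            ultimately have "exp (r + 1) < 3 / ?w"
              by (simp add: pos_less_divide_eq mult.commute)
            then have "ln (exp (r + 1)) < ln (3 / ?w)"
              using \<open>0 < ?w\<close> by (subst ln_less_cancel_iff) auto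
            then have "r < ln (3 / ?w)" by simp
            then show ?case
              using r in_A[of n] by (simp add: V_def ennreal_less_iff)
          qed
        qed
        with elim(2) show False by (simp add: top_unique)
      qed
    qed
  qed
  then have "AE \<omega> in M. \<forall>T n. 1 / real (Suc n) \<le> weight (lo T \<omega>) (hi T \<omega>) \<longrightarrow> (\<forall>t\<ge>T. hi t \<omega> < \<epsilon> / 2) \<longrightarrow>
      \<not> (\<lambda>t. hi t \<omega>) \<longlonglongrightarrow> 0"
    unfolding AE_all_countable by simp
  with AE_regular AE_hi_eventually_pos show ?thesis
  proof eventually_elim
    case (elim \<omega>)
    show ?case
    proof
      assume lim: "(\<lambda>t. hi t \<omega>) \<longlonglongrightarrow> 0"
      obtain s where s: "0 < hi s \<omega>" using elim by blast
      obtain T where T: "\<And>t. T \<le> t \<Longrightarrow> hi t \<omega> < \<epsilon> / 2"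
        using order_tendstoD(2)[OF lim, of "\<epsilon> / 2"] \<epsilon> by (auto simp: eventually_sequentially)
      let ?T = "max s T"
      have "0 < hi ?T \<omega>" using hi_pos_mono[OF elim(1) s] by simp
      then have "0 < weight (lo ?T \<omega>) (hi ?T \<omega>)" by (auto simp: weight_def)
      then obtain n where "1 / real (Suc n) < weight (lo ?T \<omega>) (hi ?T \<omega>)"
        using nat_approx_posE by metis
      then show False
        using elim(3) T lim by (metis less_imp_le max.boundedE)
    qed
  qed
qed

section \<open>Climbing to one\<close>

text \<open>
  A level \<open>g \<le> \<rho>\<close> that \<open>hi\<close> exceeds infinitely often can be raised by a fixed factor \<open>l > 1\<close>: wait
  for a new point in \<open>(l g, l\<^sup>2 g)\<close>. Finitely many rounds lead to the level \<open>\<rho>\<close>, and then a new point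
  above \<open>\<rho>\<close> makes the middle point, which becomes \<open>lo\<close>, exceed \<open>\<rho>\<close>.
\<close>
lemma AE_lo_reaches:
  assumes \<rho>: "0 < \<rho>" "\<rho> < 1" "3 - 2 * p < (4 * p - 3) * \<rho>" and d: "0 < d"
  shows "AE \<omega> in M. (\<exists>\<^sub>\<infinity>t. d \<le> hi t \<omega>) \<longrightarrow> (\<exists>t. \<rho> \<le> lo t \<omega>)"
proof -
  \<comment> \<open>\<open>l\<^sup>2 \<le> p\<close> makes the step safe, \<open>l \<rho> < 1\<close> keeps the target interval inside the support.\<close>
  obtain l where l: "1 < l" "l * l \<le> p" "l * \<rho> < 1"
  proof
    let ?l = "min (sqrt p) ((1 + 1 / \<rho>) / 2)"
    have "?l * ?l \<le> sqrt p * sqrt p" using p_gt_1 \<rho> by (intro mult_mono) auto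
    then show "?l * ?l \<le> p" using p_gt_1 by simp
    show "1 < ?l" using p_gt_1 \<rho> by (simp add: field_simps)
    have "?l * \<rho> \<le> (1 + 1 / \<rho>) / 2 * \<rho>" using \<rho> by (intro mult_right_mono min.cobounded2) simp
    also have "\<dots> < 1" using \<rho> by (simp add: field_simps)
    finally show "?l * \<rho> < 1" .
  qed
  have hi_pred: "{\<omega> \<in> space M. g \<le> hi t \<omega>} \<in> sets (history t)" for g t
  proof -
    have [measurable]: "hi t \<in> borel_measurable (history t)" by (simp add: hi_history)
    have "{\<omega> \<in> space (history t). g \<le> hi t \<omega>} \<in> sets (history t)" by measurable
    then show ?thesis by simp
  qed
  have climb: "AE \<omega> in M. (\<exists>\<^sub>\<infinity>t. g \<le> hi t \<omega>) \<longrightarrow> (\<exists>\<^sub>\<infinity>t. l * g \<le> hi t \<omega>)"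
    if g: "0 < g" "g \<le> \<rho>" for g
  proof -
    have "l * g \<le> l * \<rho>" using l g by simp
    then have lg: "l * g < 1" using l by linarith
    have "AE \<omega> in M. (\<exists>\<^sub>\<infinity>t. g \<le> hi t \<omega>) \<longrightarrow>
        (\<exists>\<^sub>\<infinity>t. g \<le> hi t \<omega> \<and> \<zeta> (Suc t) \<omega> \<in> {l * g<..<min 1 (l * (l * g))})"
      using g l lg hi_pred by (intro infinitely_often_sample_in) auto
    with AE_regular show ?thesis
    proof eventually_elim
      case (elim \<omega>)
      note \<omega> = regularD(1)[OF elim(1)]
      have up: "l * g \<le> hi (Suc t) \<omega>"
        if t: "g \<le> hi t \<omega>" "\<zeta> (Suc t) \<omega> \<in> {l * g<..<min 1 (l * (l * g))}" for t
      proof -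
        have "\<zeta> (Suc t) \<omega> \<le> (l * l) * g" using t(2) by (simp add: mult.assoc)
        also have "\<dots> \<le> p * hi t \<omega>" using t(1) l g p_gt_1 by (intro mult_mono) auto
        finally have "\<zeta> (Suc t) \<omega> \<le> hi (Suc t) \<omega>"
          unfolding hi_Suc[OF \<omega>]
          using core_in_unit[OF elim(1), of t] lo_le_hi[OF \<omega>, of t] t(1) g regularD(2)[OF elim(1), of t] p_gt_1
          by (intro next_hi_climbs) auto
        then show ?thesis using t(2) by simp
      qed
      show ?case
      proof
        assume "\<exists>\<^sub>\<infinity>t. g \<le> hi t \<omega>"
        with elim(2) have "\<exists>\<^sub>\<infinity>t. l * g \<le> hi (Suc t) \<omega>"
          using up by (auto elim: INFM_mono)
        then show "\<exists>\<^sub>\<infinity>t. l * g \<le> hi t \<omega>"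
          unfolding INFM_nat by (meson less_SucI)
      qed
    qed
  qed
  have iterate: "AE \<omega> in M. (\<exists>\<^sub>\<infinity>t. d \<le> hi t \<omega>) \<longrightarrow> (\<exists>\<^sub>\<infinity>t. min \<rho> (d * l ^ n) \<le> hi t \<omega>)" for n
  proof (induction n)
    case 0
    show ?case by (intro AE_I2) (auto elim: INFM_mono)
  next
    case (Suc n)
    let ?g = "min \<rho> (d * l ^ n)"
    have g: "0 < ?g" "?g \<le> \<rho>" using \<rho> d l by auto
    have le: "min \<rho> (d * l ^ Suc n) \<le> l * ?g"
    proof (cases "\<rho> \<le> d * l ^ n")
      case True
      then have "\<rho> * 1 \<le> l * ?g" using l \<rho> by (simp add: min_def)
      then show ?thesis by simp
    next
      case False
      then show ?thesis by (simp add: min_def mult.left_commute)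
    qed
    have "(\<exists>\<^sub>\<infinity>t. l * ?g \<le> hi t \<omega>) \<Longrightarrow> (\<exists>\<^sub>\<infinity>t. min \<rho> (d * l ^ Suc n) \<le> hi t \<omega>)" for \<omega>
      by (erule INFM_mono) (rule order_trans[OF le])
    with Suc climb[OF g] show ?case by (auto elim: eventually_elim2)
  qed
  obtain n where "\<rho> / d < l ^ n"
    using real_arch_pow[OF l(1)] by blast
  then have n: "min \<rho> (d * l ^ n) = \<rho>" using d by (simp add: field_simps min_def)
  have "AE \<omega> in M. (\<exists>\<^sub>\<infinity>t. \<rho> \<le> hi t \<omega>) \<longrightarrow> (\<exists>\<^sub>\<infinity>t. \<rho> \<le> hi t \<omega> \<and> \<zeta> (Suc t) \<omega> \<in> {\<rho><..<1})"
    using \<rho> hi_pred by (intro infinitely_often_sample_in) auto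
  with AE_regular iterate[of n] show ?thesis
  proof eventually_elim
    case (elim \<omega>)
    note \<omega> = regularD(1)[OF elim(1)]
    show ?case
    proof
      assume "\<exists>\<^sub>\<infinity>t. d \<le> hi t \<omega>"
      then have "\<exists>\<^sub>\<infinity>t. \<rho> \<le> hi t \<omega> \<and> \<zeta> (Suc t) \<omega> \<in> {\<rho><..<1}"
        using elim(2,3) n by simp
      then obtain t where t: "\<rho> \<le> hi t \<omega> \<and> \<zeta> (Suc t) \<omega> \<in> {\<rho><..<1}"
        by (rule INFM_E)
      then have c: "\<rho> \<le> middle (lo t \<omega>) (hi t \<omega>) (\<zeta> (Suc t) \<omega>)" by (auto simp: middle_def)
      then have "\<rho> \<le> lo (Suc t) \<omega>"
        unfolding lo_Suc[OF \<omega>]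
        using next_core_top_two(1)[OF p_gt_1 \<rho>(1,3) _ _ _ _ _ c] core_in_unit[OF elim(1), of t] lo_le_hi[OF \<omega>, of t]
          regularD(2,3)[OF elim(1), of t]
        by simp
      then show "\<exists>t. \<rho> \<le> lo t \<omega>" by blast
    qed
  qed
qed

text \<open>
  Above \<open>\<rho>\<close> the two largest points always survive, so both points are non-decreasing in time. The
  first new point near 1 pushes up \<open>hi\<close>, the second one pushes up \<open>lo\<close>.
\<close>
lemma lo_tendsto_1:
  assumes \<rho>: "0 < \<rho>" "3 - 2 * p < (4 * p - 3) * \<rho>" and reg: "regular \<omega>" and start: "\<rho> \<le> lo s \<omega>"
    and near_1: "\<And>n. \<exists>\<^sub>\<infinity>t. 1 - 1 / real (Suc n) < \<zeta> (Suc t) \<omega>"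
  shows "(\<lambda>t. lo t \<omega>) \<longlonglongrightarrow> 1" "(\<lambda>t. hi t \<omega>) \<longlonglongrightarrow> 1"
proof -
  note \<omega> = regularD(1)[OF reg]
  have top_two: "lo (Suc t) \<omega> = middle (lo t \<omega>) (hi t \<omega>) (\<zeta> (Suc t) \<omega>) \<and> hi (Suc t) \<omega> = max (hi t \<omega>) (\<zeta> (Suc t) \<omega>)"
    if "\<rho> \<le> lo t \<omega>" for t
  proof -
    have "\<rho> \<le> middle (lo t \<omega>) (hi t \<omega>) (\<zeta> (Suc t) \<omega>)" using that by (simp add: middle_def)
    note next_core_top_two[OF p_gt_1 \<rho> core_in_unit(1)[OF reg] lo_le_hi[OF \<omega>] core_in_unit(2)[OF reg] _ _ this]
    then show ?thesis using regularD(2,3)[OF reg, of t] by (simp add: lo_Suc[OF \<omega>] hi_Suc[OF \<omega>])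
  qed
  have above: "\<rho> \<le> lo t \<omega>" if "s \<le> t" for t
    using that by (induction rule: dec_induct) (use start top_two in \<open>auto simp: middle_def\<close>)
  have step: "lo t \<omega> \<le> lo (Suc t) \<omega>" "hi t \<omega> \<le> hi (Suc t) \<omega>" "\<zeta> (Suc t) \<omega> \<le> hi (Suc t) \<omega>"
    "min (hi t \<omega>) (\<zeta> (Suc t) \<omega>) \<le> lo (Suc t) \<omega>" if "s \<le> t" for t
    using top_two[OF above[OF that]] by (auto simp: middle_def)
  have lo_mono: "lo t \<omega> \<le> lo t' \<omega>" if "s \<le> t" "t \<le> t'" for t t'
    using that(2) by (induction rule: dec_induct) (auto intro: order_trans step(1) le_trans[OF that(1)])
  have hi_mono: "hi t \<omega> \<le> hi t' \<omega>" if "s \<le> t" "t \<le> t'" for t t'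
    using that(2) by (induction rule: dec_induct) (auto intro: order_trans step(2) le_trans[OF that(1)])
  have ev: "eventually (\<lambda>t. 1 - 1 / real (Suc n) < lo t \<omega>) sequentially" for n
  proof -
    obtain t where t: "s \<le> t" "1 - 1 / real (Suc n) < \<zeta> (Suc t) \<omega>"
      using near_1[of n] by (auto simp: INFM_nat_le)
    obtain u where u: "Suc t \<le> u" "1 - 1 / real (Suc n) < \<zeta> (Suc u) \<omega>"
      using near_1[of n] by (auto simp: INFM_nat_le)
    have "1 - 1 / real (Suc n) < hi (Suc t) \<omega>" using t step(3)[of t] by linarith
    also have "\<dots> \<le> hi u \<omega>" using t u by (intro hi_mono) auto
    finally have "1 - 1 / real (Suc n) < lo (Suc u) \<omega>" using u t step(4)[of u] by auto
    then have "1 - 1 / real (Suc n) < lo v \<omega>" if "Suc u \<le> v" for v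
      using lo_mono[of "Suc u" v] that t u by simp
    then show ?thesis by (auto simp: eventually_sequentially)
  qed
  show lo: "(\<lambda>t. lo t \<omega>) \<longlonglongrightarrow> 1"
  proof (rule order_tendstoI)
    fix a :: real assume "a < 1"
    then obtain n where n: "1 / real (Suc n) < 1 - a" using nat_approx_posE[of "1 - a"] by auto
    show "eventually (\<lambda>t. a < lo t \<omega>) sequentially"
      using ev[of n] by eventually_elim (use n in linarith)
  next
    fix a :: real assume "1 < a"
    then show "eventually (\<lambda>t. lo t \<omega> < a) sequentially"
      using core_in_unit(2)[OF reg] lo_le_hi[OF \<omega>] by (intro always_eventually) (meson le_less_trans)
  qed
  show "(\<lambda>t. hi t \<omega>) \<longlonglongrightarrow> 1"
    by (rule tendsto_sandwich[OF _ _ lo tendsto_const])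
      (use core_in_unit(2)[OF reg] lo_le_hi[OF \<omega>] in auto)
qed

lemma AE_core_tendsto_1: "AE \<omega> in M. (\<lambda>t. lo t \<omega>) \<longlonglongrightarrow> 1 \<and> (\<lambda>t. hi t \<omega>) \<longlonglongrightarrow> 1"
proof -
  obtain \<rho> where \<rho>: "0 < \<rho>" "\<rho> < 1" "3 - 2 * p < (4 * p - 3) * \<rho>"
  proof -
    have "max 0 ((3 - 2 * p) / (4 * p - 3)) < 1" using p_gt_1 by (simp add: field_simps)
    then obtain \<rho> where "max 0 ((3 - 2 * p) / (4 * p - 3)) < \<rho>" "\<rho> < 1" using dense by blast
    then show ?thesis using p_gt_1 by (intro that[of \<rho>]) (auto simp: field_simps)
  qed
  have "AE \<omega> in M. \<forall>n. (\<exists>\<^sub>\<infinity>t. 1 / real (Suc n) \<le> hi t \<omega>) \<longrightarrow> (\<exists>t. \<rho> \<le> lo t \<omega>)"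
    unfolding AE_all_countable using AE_lo_reaches[OF \<rho>] by simp
  moreover have "AE \<omega> in M. \<forall>n. \<exists>\<^sub>\<infinity>t. 1 - 1 / real (Suc n) < \<zeta> (Suc t) \<omega>"
    unfolding AE_all_countable
  proof
    fix n
    have "AE \<omega> in M. (\<exists>\<^sub>\<infinity>t::nat. True) \<longrightarrow> (\<exists>\<^sub>\<infinity>t. True \<and> \<zeta> (Suc t) \<omega> \<in> {1 - 1 / real (Suc n)<..<1})"
      using sets.top[of "history t" for t] by (intro infinitely_often_sample_in) auto
    then show "AE \<omega> in M. \<exists>\<^sub>\<infinity>t. 1 - 1 / real (Suc n) < \<zeta> (Suc t) \<omega>"
      by eventually_elim (auto elim: INFM_mono)
  qed
  ultimately show ?thesis
    using AE_regular AE_hi_not_tendsto_0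
  proof eventually_elim
    case (elim \<omega>)
    have "\<exists>n. \<exists>\<^sub>\<infinity>t. 1 / real (Suc n) \<le> hi t \<omega>"
    proof (rule ccontr)
      assume "\<not> ?thesis"
      then have small: "eventually (\<lambda>t. hi t \<omega> < 1 / real (Suc n)) sequentially" for n
        by (simp add: not_frequently not_le cofinite_eq_sequentially)
      have "(\<lambda>t. hi t \<omega>) \<longlonglongrightarrow> 0"
      proof (rule order_tendstoI)
        fix a :: real assume "a < 0"
        then show "eventually (\<lambda>t. a < hi t \<omega>) sequentially"
          using core_in_unit(1)[OF elim(3)] lo_le_hi[OF regularD(1)[OF elim(3)]]
          by (intro always_eventually) (meson less_le_trans order_trans)
      next
        fix a :: real assume "0 < a"
        then obtain n where n: "1 / real (Suc n) < a" using nat_approx_posE by blast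
        show "eventually (\<lambda>t. hi t \<omega> < a) sequentially"
          using small[of n] by eventually_elim (use n in linarith)
      qed
      with elim show False by blast
    qed
    then obtain s where "\<rho> \<le> lo s \<omega>" using elim by blast
    then show ?case
      using lo_tendsto_1[OF \<rho>(1,3) elim(3)] elim(2) by blast
  qed
qed

end

theorem theorem3:
  fixes M :: "'w measure" and p :: real and D :: "real measure"
    and \<zeta> :: "nat \<Rightarrow> 'w \<Rightarrow> real" and tie :: "nat \<Rightarrow> 'w \<Rightarrow> bool"
    and X :: "nat \<Rightarrow> 'w \<Rightarrow> real multiset"
  assumes "p_contest M 3 p D \<zeta> tie X"
    and "p > 1"
    and "full_support D"
    and "nondecreasing_density_near_zero D"
    and "p < 3 / 2 \<Longrightarrow> AE \<omega> in M. count (X 0 \<omega>) 0 < 2"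
  shows "AE \<omega> in M. \<forall>i\<in>{1, 2}.
           (\<lambda>t. order_point (core p (tie t \<omega>) (X t \<omega>)) i) \<longlonglongrightarrow> 1"
proof -
  interpret p_contest M 3 p D \<zeta> tie X by fact
  interpret admissible_contest M p D \<zeta> tie X
    by unfold_locales (use assms in auto)
  show ?thesis
    using AE_core_tendsto_1 unfolding lo_def hi_def by eventually_elim auto
qed

end
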